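(* Let $M$ be an oriented smooth $4$-manifold with a Riemannian metric $g$ with Levi-Civita connection $\nabla$, and a $g$-orthogonal almost-complex structure $J$ compatible with the orientation, with fundamental form $\omega(v,w)=g(Jv,w)$. Let $\mathcal{S}$ be the set of all connections $D$ on $T_M$ that are $g$-metric, $\mathbb{C}$-linear for $J$, and such that the connections induced by $D$ and by $\nabla$ on $\Lambda^{-}(T_M^{*})$ coincide. Then $(M,g,\omega)$ is almost-Kähler if and only if there is a connection $\widetilde\nabla\in\mathcal{S}$ that simultaneously is closest to $\nabla$ and has minimal torsion among the connections in $\mathcal{S}$.
   Context: $(M,g,\omega)$ is almost-Kähler if $d\omega=0$. $\Lambda^-$ is the bundle of anti-self-dual $2$-forms. "Closest to $\nabla$" means that at every point $x\in M$ the norm of the tensor $(X,Y)\mapsto \widetilde\nabla_XY-\nabla_XY$ in $T_M^*\otimes T_M^*\otimes T_M|_x$ is minimal among all $D\in\mathcal{S}$; "minimal torsion" means that at every point $x$ the norm of the torsion $\mathrm{Tor}^{\widetilde\nabla}(X,Y)=\widetilde\nabla_XY-\widetilde\nabla_YX-[X,Y]$ in $T_M^*\otimes T_M^*\otimes T_M|_x$ is minimal among all $D\in\mathcal{S}$. Norms come from $\langle T_1,T_2\rangle=\sum_{j,k=1}^4 g(T_1(e_j,e_k),T_2(e_j,e_k))$ for a $g$-orthonormal basis $\{e_k\}$ of $T_M|_x$. *)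

theory Defs
  imports "HOL-Analysis.Analysis"
begin

section \<open>Smooth functions on open subsets of a Euclidean space\<close>

text \<open>On an open subset of a finite-dimensional space, a function is \<open>C\<^sup>k\<^sup>+\<^sup>1\<close> iff it is
  differentiable and all its directional derivatives are \<open>C\<^sup>k\<close>. The definition is meant for
  open \<open>U\<close> only.\<close>

primrec C_k_on ::
  "nat \<Rightarrow> ('a::euclidean_space \<Rightarrow> 'b::real_normed_vector) \<Rightarrow> 'a set \<Rightarrow> bool" where
  "C_k_on 0 = (\<lambda>f U. continuous_on U f)"
| "C_k_on (Suc k) = (\<lambda>f U. (\<forall>x\<in>U. f differentiable (at x)) \<and>
      (\<forall>v. C_k_on k (\<lambda>x. frechet_derivative f (at x) v) U))"

definition smooth_on :: "'a::euclidean_space set \<Rightarrow> ('a \<Rightarrow> 'b::real_normed_vector) \<Rightarrow> bool" where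
  "smooth_on U f \<longleftrightarrow> (\<forall>k. C_k_on k f U)"

section \<open>Oriented smooth 4-manifolds\<close>

text \<open>The manifold is the whole type \<open>'m\<close>; a chart \<open>(U, \<phi>)\<close> consists of its domain and its
  coordinate map, whose values outside \<open>U\<close> are irrelevant.\<close>

type_synonym 'm chart = "'m set \<times> ('m \<Rightarrow> real^4)"

definition chart_inv :: "'m chart \<Rightarrow> real^4 \<Rightarrow> 'm" where
  "chart_inv c = inv_into (fst c) (snd c)"

definition is_chart :: "'m::topological_space chart \<Rightarrow> bool" where
  "is_chart c \<longleftrightarrow> open (fst c) \<and> open (snd c ` fst c) \<and>
     homeomorphism (fst c) (snd c ` fst c) (snd c) (chart_inv c)"

definition transition :: "'m chart \<Rightarrow> 'm chart \<Rightarrow> real^4 \<Rightarrow> real^4" where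
  "transition c d = snd d \<circ> chart_inv c"

text \<open>An orientation is given by an atlas whose transition maps have positive Jacobian
  determinant. The atlas need not be maximal.\<close>

definition oriented_atlas :: "'m::topological_space chart set \<Rightarrow> bool" where
  "oriented_atlas A \<longleftrightarrow>
     (\<forall>c\<in>A. is_chart c) \<and> (\<Union>c\<in>A. fst c) = UNIV \<and>
     (\<forall>c\<in>A. \<forall>d\<in>A. smooth_on (snd c ` (fst c \<inter> fst d)) (transition c d) \<and>
        (\<forall>u \<in> snd c ` (fst c \<inter> fst d).
           det (matrix (frechet_derivative (transition c d) (at u))) > 0))"

definition smooth_fun :: "'m chart set \<Rightarrow> ('m \<Rightarrow> real) \<Rightarrow> bool" where
  "smooth_fun A f \<longleftrightarrow> (\<forall>c\<in>A. smooth_on (snd c ` fst c) (f \<circ> chart_inv c))"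

section \<open>Tangent vectors and vector fields\<close>

text \<open>The tangent space at \<open>x\<close>, that is the set of pairs (chart around \<open>x\<close>, vector of
  \<open>real^4\<close>) modulo the derivatives of the transition maps, is identified with \<open>real^4\<close> through
  the chart \<open>chart_at A x\<close>, chosen once and for all. The choice need not depend continuously on
  \<open>x\<close>, and neither do the components: smoothness has to be tested on the components
  \<open>coord A c x\<close> with respect to a fixed chart \<open>c\<close> around \<open>x\<close>.\<close>

definition chart_at :: "'m chart set \<Rightarrow> 'm \<Rightarrow> 'm chart" where
  "chart_at A x = (SOME c. c \<in> A \<and> x \<in> fst c)"

definition coord :: "'m chart set \<Rightarrow> 'm chart \<Rightarrow> 'm \<Rightarrow> real^4 \<Rightarrow> real^4" where
  "coord A c x v =
     frechet_derivative (transition (chart_at A x) c) (at (snd (chart_at A x) x)) v"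

type_synonym 'm vfield = "'m \<Rightarrow> real^4"

definition local_rep :: "'m chart set \<Rightarrow> 'm chart \<Rightarrow> 'm vfield \<Rightarrow> real^4 \<Rightarrow> real^4" where
  "local_rep A c X u = coord A c (chart_inv c u) (X (chart_inv c u))"

definition smooth_vfield :: "'m chart set \<Rightarrow> 'm vfield \<Rightarrow> bool" where
  "smooth_vfield A X \<longleftrightarrow> (\<forall>c\<in>A. smooth_on (snd c ` fst c) (local_rep A c X))"

definition dir_deriv :: "'m chart set \<Rightarrow> 'm vfield \<Rightarrow> ('m \<Rightarrow> real) \<Rightarrow> 'm \<Rightarrow> real" where
  "dir_deriv A X f x =
     frechet_derivative (f \<circ> chart_inv (chart_at A x)) (at (snd (chart_at A x) x)) (X x)"

text \<open>The Lie bracket \<open>[X, Y]\<^sup>i = X\<^sup>j \<partial>\<^sub>j Y\<^sup>i - Y\<^sup>j \<partial>\<^sub>j X\<^sup>i\<close>,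
  computed at \<open>x\<close> in the chart \<open>chart_at A x\<close>.\<close>

definition lie_bracket :: "'m chart set \<Rightarrow> 'm vfield \<Rightarrow> 'm vfield \<Rightarrow> 'm vfield" where
  "lie_bracket A X Y x = (let c = chart_at A x; u = snd c x in
     frechet_derivative (local_rep A c Y) (at u) (X x)
     - frechet_derivative (local_rep A c X) (at u) (Y x))"

section \<open>Riemannian metrics, orientation, almost complex structures\<close>

type_synonym 'm form2 = "'m \<Rightarrow> real^4 \<Rightarrow> real^4 \<Rightarrow> real"

definition smooth_bilinear_form :: "'m chart set \<Rightarrow> 'm form2 \<Rightarrow> bool" where
  "smooth_bilinear_form A b \<longleftrightarrow> (\<forall>x. bilinear (b x)) \<and>
     (\<forall>X Y. smooth_vfield A X \<longrightarrow> smooth_vfield A Y \<longrightarrow> smooth_fun A (\<lambda>x. b x (X x) (Y x)))"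

definition riemannian_metric :: "'m chart set \<Rightarrow> 'm form2 \<Rightarrow> bool" where
  "riemannian_metric A g \<longleftrightarrow> smooth_bilinear_form A g \<and>
     (\<forall>x v w. g x v w = g x w v) \<and> (\<forall>x v. v \<noteq> 0 \<longrightarrow> g x v v > 0)"

text \<open>As the atlas is oriented, a basis of the tangent space at \<open>x\<close> is positively oriented iff
  the determinant of its components in \<open>chart_at A x\<close>, i.e. in \<open>real^4\<close>, is positive.\<close>

definition positively_oriented :: "real^4 \<Rightarrow> real^4 \<Rightarrow> real^4 \<Rightarrow> real^4 \<Rightarrow> bool" where
  "positively_oriented a b c d \<longleftrightarrow> det (vector [a, b, c, d] :: real^4^4) > 0"

definition orthonormal_basis :: "'m form2 \<Rightarrow> 'm \<Rightarrow> (4 \<Rightarrow> real^4) \<Rightarrow> bool" where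
  "orthonormal_basis g x e \<longleftrightarrow> (\<forall>i j. g x (e i) (e j) = (if i = j then 1 else 0))"

definition almost_complex_structure ::
  "'m chart set \<Rightarrow> ('m \<Rightarrow> real^4 \<Rightarrow> real^4) \<Rightarrow> bool" where
  "almost_complex_structure A J \<longleftrightarrow>
     (\<forall>x. linear (J x) \<and> (\<forall>v. J x (J x v) = - v)) \<and>
     (\<forall>X. smooth_vfield A X \<longrightarrow> smooth_vfield A (\<lambda>x. J x (X x)))"

definition orthogonal_structure :: "'m form2 \<Rightarrow> ('m \<Rightarrow> real^4 \<Rightarrow> real^4) \<Rightarrow> bool" where
  "orthogonal_structure g J \<longleftrightarrow> (\<forall>x v w. g x (J x v) (J x w) = g x v w)"

text \<open>The orientation induced by \<open>J\<close> is the one for which complex bases \<open>(v, w)\<close> give positively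
  oriented real bases \<open>(v, J v, w, J w)\<close>.\<close>

definition compatible_with_orientation :: "('m \<Rightarrow> real^4 \<Rightarrow> real^4) \<Rightarrow> bool" where
  "compatible_with_orientation J \<longleftrightarrow>
     (\<forall>x v w. v \<noteq> 0 \<and> w \<notin> span {v, J x v} \<longrightarrow> positively_oriented v (J x v) w (J x w))"

definition fundamental_form :: "'m form2 \<Rightarrow> ('m \<Rightarrow> real^4 \<Rightarrow> real^4) \<Rightarrow> 'm form2" where
  "fundamental_form g J x v w = g x (J x v) w"

section \<open>Two-forms\<close>

definition two_form :: "'m chart set \<Rightarrow> 'm form2 \<Rightarrow> bool" where
  "two_form A \<alpha> \<longleftrightarrow> smooth_bilinear_form A \<alpha> \<and> (\<forall>x v. \<alpha> x v v = 0)"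

text \<open>Cartan's invariant formula, normalised so that \<open>d(f dx\<^sup>1 \<and> dx\<^sup>2) = df \<and> dx\<^sup>1 \<and> dx\<^sup>2\<close> without a
  factor \<open>1/3\<close>.\<close>

definition ext_deriv ::
  "'m chart set \<Rightarrow> 'm form2 \<Rightarrow> 'm vfield \<Rightarrow> 'm vfield \<Rightarrow> 'm vfield \<Rightarrow> 'm \<Rightarrow> real" where
  "ext_deriv A \<alpha> X Y Z x =
     dir_deriv A X (\<lambda>y. \<alpha> y (Y y) (Z y)) x
     - dir_deriv A Y (\<lambda>y. \<alpha> y (X y) (Z y)) x
     + dir_deriv A Z (\<lambda>y. \<alpha> y (X y) (Y y)) x
     - \<alpha> x (lie_bracket A X Y x) (Z x)
     + \<alpha> x (lie_bracket A X Z x) (Y x)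
     - \<alpha> x (lie_bracket A Y Z x) (X x)"

definition almost_kaehler ::
  "'m chart set \<Rightarrow> 'm form2 \<Rightarrow> ('m \<Rightarrow> real^4 \<Rightarrow> real^4) \<Rightarrow> bool" where
  "almost_kaehler A g J \<longleftrightarrow>
     (\<forall>X Y Z x. smooth_vfield A X \<longrightarrow> smooth_vfield A Y \<longrightarrow> smooth_vfield A Z \<longrightarrow>
        ext_deriv A (fundamental_form g J) X Y Z x = 0)"

definition positive_orthonormal_basis :: "'m form2 \<Rightarrow> 'm \<Rightarrow> (4 \<Rightarrow> real^4) \<Rightarrow> bool" where
  "positive_orthonormal_basis g x e \<longleftrightarrow>
     orthonormal_basis g x e \<and> positively_oriented (e 1) (e 2) (e 3) (e 4)"

text \<open>The value of the Riemannian volume form on \<open>(a, b, c, d)\<close> is the determinant of their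
  components in a positive orthonormal basis \<open>e\<close>, and
  \<open>(\<star>\<alpha>)(v, w) = 1/2 \<Sum>\<^sub>j\<^sub>k \<alpha>(e\<^sub>j, e\<^sub>k) vol(e\<^sub>j, e\<^sub>k, v, w)\<close>; in particular
  \<open>(\<star>\<alpha>)(e\<^sub>3, e\<^sub>4) = \<alpha>(e\<^sub>1, e\<^sub>2)\<close>. Neither depends on the choice of \<open>e\<close>.\<close>

definition volume_form ::
  "'m form2 \<Rightarrow> 'm \<Rightarrow> real^4 \<Rightarrow> real^4 \<Rightarrow> real^4 \<Rightarrow> real^4 \<Rightarrow> real" where
  "volume_form g x a b c d =
     (let e = (SOME e. positive_orthonormal_basis g x e);
          comp = (\<lambda>v. \<chi> i. g x (e i) v)
      in det (vector [comp a, comp b, comp c, comp d] :: real^4^4))"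

definition hodge_star :: "'m form2 \<Rightarrow> 'm form2 \<Rightarrow> 'm form2" where
  "hodge_star g \<alpha> x v w =
     (let e = (SOME e. orthonormal_basis g x e)
      in 1/2 * (\<Sum>j\<in>UNIV. \<Sum>k\<in>UNIV. \<alpha> x (e j) (e k) * volume_form g x (e j) (e k) v w))"

definition anti_self_dual_form :: "'m chart set \<Rightarrow> 'm form2 \<Rightarrow> 'm form2 \<Rightarrow> bool" where
  "anti_self_dual_form A g \<alpha> \<longleftrightarrow>
     two_form A \<alpha> \<and> (\<forall>x v w. hodge_star g \<alpha> x v w = - \<alpha> x v w)"

section \<open>Connections on the tangent bundle\<close>

text \<open>A connection is only constrained on smooth vector fields; its values on other arguments are
  irrelevant and never used.\<close>

type_synonym 'm conn = "'m vfield \<Rightarrow> 'm vfield \<Rightarrow> 'm vfield"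

definition connection :: "'m chart set \<Rightarrow> 'm conn \<Rightarrow> bool" where
  "connection A D \<longleftrightarrow>
     (\<forall>X Y. smooth_vfield A X \<longrightarrow> smooth_vfield A Y \<longrightarrow> smooth_vfield A (D X Y)) \<and>
     (\<forall>X Y Z. smooth_vfield A X \<longrightarrow> smooth_vfield A Y \<longrightarrow> smooth_vfield A Z \<longrightarrow>
        D (\<lambda>x. X x + Y x) Z = (\<lambda>x. D X Z x + D Y Z x) \<and>
        D X (\<lambda>x. Y x + Z x) = (\<lambda>x. D X Y x + D X Z x)) \<and>
     (\<forall>f X Y. smooth_fun A f \<longrightarrow> smooth_vfield A X \<longrightarrow> smooth_vfield A Y \<longrightarrow>
        D (\<lambda>x. f x *\<^sub>R X x) Y = (\<lambda>x. f x *\<^sub>R D X Y x) \<and>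
        D X (\<lambda>x. f x *\<^sub>R Y x) = (\<lambda>x. dir_deriv A X f x *\<^sub>R Y x + f x *\<^sub>R D X Y x))"

definition metric_connection :: "'m chart set \<Rightarrow> 'm form2 \<Rightarrow> 'm conn \<Rightarrow> bool" where
  "metric_connection A g D \<longleftrightarrow>
     (\<forall>X Y Z x. smooth_vfield A X \<longrightarrow> smooth_vfield A Y \<longrightarrow> smooth_vfield A Z \<longrightarrow>
        dir_deriv A X (\<lambda>y. g y (Y y) (Z y)) x = g x (D X Y x) (Z x) + g x (Y x) (D X Z x))"

definition complex_linear_connection ::
  "'m chart set \<Rightarrow> ('m \<Rightarrow> real^4 \<Rightarrow> real^4) \<Rightarrow> 'm conn \<Rightarrow> bool" where
  "complex_linear_connection A J D \<longleftrightarrow>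
     (\<forall>X Y. smooth_vfield A X \<longrightarrow> smooth_vfield A Y \<longrightarrow>
        D X (\<lambda>x. J x (Y x)) = (\<lambda>x. J x (D X Y x)))"

definition torsion :: "'m chart set \<Rightarrow> 'm conn \<Rightarrow> 'm conn" where
  "torsion A D X Y x = D X Y x - D Y X x - lie_bracket A X Y x"

definition levi_civita :: "'m chart set \<Rightarrow> 'm form2 \<Rightarrow> 'm conn \<Rightarrow> bool" where
  "levi_civita A g D \<longleftrightarrow> connection A D \<and> metric_connection A g D \<and>
     (\<forall>X Y x. smooth_vfield A X \<longrightarrow> smooth_vfield A Y \<longrightarrow> torsion A D X Y x = 0)"

text \<open>The induced connection on two-forms, \<open>(D\<^sub>X \<alpha>)(Y, Z)\<close>. For a metric connection it preserves
  the bundle of anti-self-dual forms.\<close>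

definition induced_conn ::
  "'m chart set \<Rightarrow> 'm conn \<Rightarrow> 'm vfield \<Rightarrow> 'm form2 \<Rightarrow> 'm vfield \<Rightarrow> 'm vfield \<Rightarrow> 'm \<Rightarrow> real" where
  "induced_conn A D X \<alpha> Y Z x =
     dir_deriv A X (\<lambda>y. \<alpha> y (Y y) (Z y)) x - \<alpha> x (D X Y x) (Z x) - \<alpha> x (Y x) (D X Z x)"

definition same_induced_on_asd ::
  "'m chart set \<Rightarrow> 'm form2 \<Rightarrow> 'm conn \<Rightarrow> 'm conn \<Rightarrow> bool" where
  "same_induced_on_asd A g D D' \<longleftrightarrow>
     (\<forall>\<alpha> X Y Z x. anti_self_dual_form A g \<alpha> \<longrightarrow>
        smooth_vfield A X \<longrightarrow> smooth_vfield A Y \<longrightarrow> smooth_vfield A Z \<longrightarrow>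
        induced_conn A D X \<alpha> Y Z x = induced_conn A D' X \<alpha> Y Z x)"

definition conn_class ::
  "'m chart set \<Rightarrow> 'm form2 \<Rightarrow> ('m \<Rightarrow> real^4 \<Rightarrow> real^4) \<Rightarrow> 'm conn \<Rightarrow> 'm conn set" where
  "conn_class A g J nabla = {D. connection A D \<and> metric_connection A g D \<and>
     complex_linear_connection A J D \<and> same_induced_on_asd A g D nabla}"

section \<open>Pointwise norms\<close>

text \<open>For an operator \<open>T\<close> on smooth vector fields which is bilinear over the smooth functions,
  \<open>T X Y x\<close> depends only on \<open>X x\<close> and \<open>Y x\<close>, so \<open>T\<close> can be evaluated on tangent vectors at \<open>x\<close>
  after extending them arbitrarily.\<close>

definition extend :: "'m chart set \<Rightarrow> 'm \<Rightarrow> real^4 \<Rightarrow> 'm vfield" where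
  "extend A x v = (SOME X. smooth_vfield A X \<and> X x = v)"

definition tensor_at ::
  "'m chart set \<Rightarrow> 'm conn \<Rightarrow> 'm \<Rightarrow> real^4 \<Rightarrow> real^4 \<Rightarrow> real^4" where
  "tensor_at A T x v w = T (extend A x v) (extend A x w) x"

definition tensor_norm :: "'m chart set \<Rightarrow> 'm form2 \<Rightarrow> 'm \<Rightarrow> 'm conn \<Rightarrow> real" where
  "tensor_norm A g x T =
     (let e = (SOME e. orthonormal_basis g x e)
      in sqrt (\<Sum>j\<in>UNIV. \<Sum>k\<in>UNIV.
            g x (tensor_at A T x (e j) (e k)) (tensor_at A T x (e j) (e k))))"

definition conn_diff :: "'m conn \<Rightarrow> 'm conn \<Rightarrow> 'm conn" where
  "conn_diff D D' X Y x = D X Y x - D' X Y x"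

definition closest_in ::
  "'m chart set \<Rightarrow> 'm form2 \<Rightarrow> 'm conn set \<Rightarrow> 'm conn \<Rightarrow> 'm conn \<Rightarrow> bool" where
  "closest_in A g S nabla D \<longleftrightarrow> D \<in> S \<and>
     (\<forall>x. \<forall>D'\<in>S. tensor_norm A g x (conn_diff D nabla) \<le> tensor_norm A g x (conn_diff D' nabla))"

definition minimal_torsion_in ::
  "'m chart set \<Rightarrow> 'm form2 \<Rightarrow> 'm conn set \<Rightarrow> 'm conn \<Rightarrow> bool" where
  "minimal_torsion_in A g S D \<longleftrightarrow> D \<in> S \<and>
     (\<forall>x. \<forall>D'\<in>S. tensor_norm A g x (torsion A D) \<le> tensor_norm A g x (torsion A D'))"

end

theory Submission
  imports Defs
begin

text \<open>Two connections that are metric, \<open>J\<close>-linear and agree on \<open>\<Lambda>\<^sup>-\<close> differ by a section of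
  \<open>T\<^sup>* \<otimes> (\<real> J)\<close>: at each point the skew endomorphisms commuting with \<open>J\<close> form
  \<open>\<real> J \<oplus> \<Lambda>\<^sup>-\<close>, and \<open>\<Lambda>\<^sup>-\<close> acts faithfully on itself. Hence the class consists of the connections
  \<open>\<nabla> - J (\<nabla>J) / 2 + a \<otimes> J\<close> with \<open>a\<close> a one-form. Since \<open>J (\<nabla>\<^sub>X J)\<close> is orthogonal to \<open>J\<close>, the one with
  \<open>a = 0\<close> is the unique closest one. The torsion norm is a quadratic polynomial in \<open>a\<close> whose linear
  term is the pairing with \<open>\<Sum>\<^sub>k (\<nabla>\<^bsub>e\<^sub>k\<^esub> J) e\<^sub>k\<close>, that is, with the codifferential of \<open>\<omega>\<close>. It is
  minimal at \<open>a = 0\<close> iff this vanishes, and in dimension four this means \<open>d\<omega> = 0\<close>.\<close>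

section \<open>Calculus of smooth functions\<close>

text \<open>A connection is an operator on global fields, and membership in the class is tested on
  global forms, whereas the norms are compared at single points. Bump functions bridge the gap: an
  operator linear over the functions depends only on values at the point, and every tangent vector
  extends to a smooth field. Membership is then exploited by testing on explicit global
  anti-self-dual forms, and minimality by competitors whose one-form is prescribed at the point; the
  factor \<open>a\<close> of a general member is determined one point at a time. The squared
  distance to \<nabla> is a constant plus 4 |a|^2, the squared torsion a constant minus 2 a(t) plus
  6 |a|^2, where t is the trace of \<nabla>J. The first is smallest at a = 0, the second at a = t/6
  (as covectors), so one connection achieves both only if t = 0. The Hodge star, the volume form and
  t are defined through frames picked by a choice operator. Independence of the frame moves the
  computations to frames f1, J f1, f3, J f3.\<close>

lemma C_k_on_Suc_has_derivative:
  assumes "C_k_on (Suc k) f U" "x \<in> U"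
  shows "(f has_derivative frechet_derivative f (at x)) (at x)"
  using assms frechet_derivative_works by auto

text \<open>A derivative at a point sees the function on a neighbourhood, so agreement on an open
  set passes to the derivatives and the induction continues with them.\<close>

lemma C_k_on_cong:
  assumes "open U" "\<And>x. x \<in> U \<Longrightarrow> f x = h x" "C_k_on k f U"
  shows "C_k_on k h U"
  using assms(2,3)
proof (induction k arbitrary: f h)
  case 0
  then show ?case using continuous_on_cong by fastforce
next
  case (Suc k)
  have h': "(h has_derivative frechet_derivative f (at x)) (at x)" if "x \<in> U" for x
    using C_k_on_Suc_has_derivative[OF Suc.prems(2) that] Suc.prems(1)
    by (rule has_derivative_transform_within_open[OF _ assms(1) that])
  have "C_k_on k (\<lambda>x. frechet_derivative h (at x) v) U" for v
  proof (rule Suc.IH)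
    show "frechet_derivative f (at x) v = frechet_derivative h (at x) v" if "x \<in> U" for x
      using frechet_derivative_at[OF h'[OF that]] by simp
  qed (use Suc.prems in auto)
  then show ?case using h' by (auto simp: differentiable_def)
qed

text \<open>Uniqueness of the derivative identifies the chosen \<open>frechet_derivative\<close>
  with any explicit formula. The closure properties below thus become inductions fed with the rules
  of differentiation.\<close>

lemma C_k_on_SucI:
  assumes "open U" "\<And>x. x \<in> U \<Longrightarrow> (f has_derivative f' x) (at x)"
    and "\<And>v. C_k_on k (\<lambda>x. f' x v) U"
  shows "C_k_on (Suc k) f U"
proof -
  have "f' x = frechet_derivative f (at x)" if "x \<in> U" for x
    using assms(2)[OF that] by (rule frechet_derivative_at)
  then have "C_k_on k (\<lambda>x. frechet_derivative f (at x) v) U" for v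
    by (intro C_k_on_cong[OF assms(1) _ assms(3)[of v]]) simp
  then show ?thesis
    using assms(2) by (auto simp: differentiable_def)
qed

lemma C_k_on_Suc_imp: "C_k_on (Suc k) f U \<Longrightarrow> C_k_on k f U"
proof (induction k arbitrary: f)
  case 0
  then show ?case
    by (auto intro!: continuous_at_imp_continuous_on differentiable_imp_continuous_within)
qed auto

lemma C_k_on_subset: "C_k_on k f U \<Longrightarrow> V \<subseteq> U \<Longrightarrow> C_k_on k f V"
  by (induction k arbitrary: f) (auto intro: continuous_on_subset)

lemma C_k_on_const: "C_k_on k (\<lambda>x. c) U"
  by (induction k arbitrary: c) auto

lemma C_k_on_add:
  assumes "open U" "C_k_on k f U" "C_k_on k g U"
  shows "C_k_on k (\<lambda>x. f x + g x) U"
  using assms(2,3)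
proof (induction k arbitrary: f g)
  case 0
  then show ?case by (auto intro: continuous_intros)
next
  case (Suc k)
  show ?case
  proof (rule C_k_on_SucI[OF assms(1)])
    show "((\<lambda>x. f x + g x) has_derivative
        (\<lambda>v. frechet_derivative f (at x) v + frechet_derivative g (at x) v)) (at x)" if "x \<in> U" for x
      by (intro has_derivative_add C_k_on_Suc_has_derivative[OF Suc.prems(1) that]
          C_k_on_Suc_has_derivative[OF Suc.prems(2) that])
  qed (use Suc in auto)
qed

lemma C_k_on_sum:
  assumes "open U" "\<And>i. i \<in> I \<Longrightarrow> C_k_on k (f i) U"
  shows "C_k_on k (\<lambda>x. \<Sum>i\<in>I. f i x) U"
  using assms(2)
  by (induction I rule: infinite_finite_induct) (auto intro!: C_k_on_add assms(1) C_k_on_const)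

text \<open>By the product rule a derivative is a sum of two terms of the same shape. One factor is
  differentiated and the other is merely lowered by one order, so the induction hypothesis covers
  both.\<close>

lemma C_k_on_bilinear:
  assumes h: "bounded_bilinear h" and "open U" "C_k_on k f U" "C_k_on k g U"
  shows "C_k_on k (\<lambda>x. h (f x) (g x)) U"
  using assms(3,4)
proof (induction k arbitrary: f g)
  case 0
  then show ?case by (auto intro: bounded_bilinear.continuous_on[OF h])
next
  case (Suc k)
  show ?case
  proof (rule C_k_on_SucI[OF assms(2)])
    show "((\<lambda>x. h (f x) (g x)) has_derivative
        (\<lambda>v. h (f x) (frechet_derivative g (at x) v) + h (frechet_derivative f (at x) v) (g x))) (at x)"
      if "x \<in> U" for x
      by (intro bounded_bilinear.FDERIV[OF h] C_k_on_Suc_has_derivative[OF Suc.prems(1) that]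
          C_k_on_Suc_has_derivative[OF Suc.prems(2) that])
    show "C_k_on k (\<lambda>x. h (f x) (frechet_derivative g (at x) v)
      + h (frechet_derivative f (at x) v) (g x)) U" for v
      using Suc.prems by (intro C_k_on_add assms(2) Suc.IH C_k_on_Suc_imp[OF Suc.prems(1)] C_k_on_Suc_imp[OF Suc.prems(2)]) auto
  qed
qed

lemma C_k_on_linear:
  assumes L: "bounded_linear L" and "open U" "C_k_on k f U"
  shows "C_k_on k (\<lambda>x. L (f x)) U"
  using assms(3)
proof (induction k arbitrary: f)
  case 0
  then show ?case by (auto intro: bounded_linear.continuous_on[OF L])
next
  case (Suc k)
  show ?case
  proof (rule C_k_on_SucI[OF assms(2)])
    show "((\<lambda>x. L (f x)) has_derivative (\<lambda>v. L (frechet_derivative f (at x) v))) (at x)"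
      if "x \<in> U" for x
      by (intro bounded_linear.has_derivative[OF L] C_k_on_Suc_has_derivative[OF Suc.prems that])
  qed (use Suc in auto)
qed

lemma C_k_on_ident: "open U \<Longrightarrow> C_k_on k (\<lambda>x. x) U"
  by (cases k) (auto intro: C_k_on_const)

lemma linear_eq_sum_Basis:
  fixes L :: "'a::euclidean_space \<Rightarrow> 'b::real_vector"
  assumes "linear L"
  shows "L w = (\<Sum>i\<in>Basis. (w \<bullet> i) *\<^sub>R L i)"
proof -
  have "L w = L (\<Sum>i\<in>Basis. (w \<bullet> i) *\<^sub>R i)" by (simp add: euclidean_representation)
  then show ?thesis using assms by (simp add: linear_sum linear_cmul)
qed

lemma C_k_on_compose:
  fixes f :: "'b::euclidean_space \<Rightarrow> 'c::real_normed_vector"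
    and p :: "'a::euclidean_space \<Rightarrow> 'b"
  assumes U: "open U" and V: "p ` U \<subseteq> V" and "C_k_on k f V" "C_k_on k p U"
  shows "C_k_on k (\<lambda>x. f (p x)) U"
  using assms(3,4)
proof (induction k arbitrary: f)
  case 0
  then show ?case using V by (auto intro: continuous_on_compose2)
next
  case (Suc k)
  let ?Df = "\<lambda>y. frechet_derivative f (at y)" and ?Dp = "\<lambda>x. frechet_derivative p (at x)"
  show ?case
  proof (rule C_k_on_SucI[OF U])
    fix x assume x: "x \<in> U"
    have f': "(f has_derivative ?Df (p x)) (at (p x))"
      using V x by (intro C_k_on_Suc_has_derivative[OF Suc.prems(1)]) auto
    have p': "(p has_derivative ?Dp x) (at x)"
      by (intro C_k_on_Suc_has_derivative[OF Suc.prems(2)] x)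
    \<comment> \<open>The chain rule differentiates \<open>f\<close> in the direction
      \<open>?Dp x v\<close>, which moves with \<open>x\<close>, while \<open>C_k_on\<close> speaks
      of fixed directions. Expansion in the basis shifts this dependence into scalar
      coefficients.\<close>
    have "(\<lambda>v. \<Sum>i\<in>Basis. (?Dp x v \<bullet> i) *\<^sub>R ?Df (p x) i) = (\<lambda>v. ?Df (p x) (?Dp x v))"
      by (intro ext linear_eq_sum_Basis[symmetric] has_derivative_linear[OF f'])
    then show "((\<lambda>x. f (p x)) has_derivative
        (\<lambda>v. \<Sum>i\<in>Basis. (?Dp x v \<bullet> i) *\<^sub>R ?Df (p x) i)) (at x)"
      using has_derivative_compose[OF p' f'] by (simp only:)
  next
    fix v
    show "C_k_on k (\<lambda>x. \<Sum>i\<in>Basis. (?Dp x v \<bullet> i) *\<^sub>R ?Df (p x) i) U"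
      using Suc.prems
      by (intro C_k_on_sum C_k_on_bilinear[OF bounded_bilinear_scaleR] U Suc.IH
          C_k_on_linear[OF bounded_linear_inner_left] C_k_on_Suc_imp[OF Suc.prems(2)]) auto
  qed
qed

lemma C_k_on_local:
  assumes "\<And>x. x \<in> U \<Longrightarrow> \<exists>V. open V \<and> x \<in> V \<and> C_k_on k f V"
  shows "C_k_on k f U"
  using assms
proof (induction k arbitrary: f)
  case 0
  have "continuous (at x) f" if "x \<in> U" for x
    using 0[OF that] by (auto simp: continuous_on_eq_continuous_at)
  then show ?case by (simp add: continuous_at_imp_continuous_on)
next
  case (Suc k)
  have "f differentiable (at x)" if "x \<in> U" for x using Suc.prems[OF that] by auto
  moreover have "C_k_on k (\<lambda>x. frechet_derivative f (at x) v) U" for v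
    by (rule Suc.IH) (use Suc.prems in fastforce)
  ultimately show ?case by simp
qed

lemma smooth_on_cong: "open U \<Longrightarrow> (\<And>x. x \<in> U \<Longrightarrow> f x = g x) \<Longrightarrow> smooth_on U f \<Longrightarrow> smooth_on U g"
  unfolding smooth_on_def using C_k_on_cong by blast

lemma smooth_on_subset: "smooth_on U f \<Longrightarrow> V \<subseteq> U \<Longrightarrow> smooth_on V f"
  unfolding smooth_on_def using C_k_on_subset by blast

lemma smooth_on_const: "smooth_on U (\<lambda>x. c)"
  by (simp add: smooth_on_def C_k_on_const)

lemma smooth_on_ident: "open U \<Longrightarrow> smooth_on U (\<lambda>x. x)"
  by (simp add: smooth_on_def C_k_on_ident)

lemma smooth_on_add: "open U \<Longrightarrow> smooth_on U f \<Longrightarrow> smooth_on U g \<Longrightarrow> smooth_on U (\<lambda>x. f x + g x)"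
  by (simp add: smooth_on_def C_k_on_add)

lemma smooth_on_bilinear:
  "bounded_bilinear h \<Longrightarrow> open U \<Longrightarrow> smooth_on U f \<Longrightarrow> smooth_on U g \<Longrightarrow> smooth_on U (\<lambda>x. h (f x) (g x))"
  by (simp add: smooth_on_def C_k_on_bilinear)

lemmas smooth_on_mult = smooth_on_bilinear[OF bounded_bilinear_mult]
lemmas smooth_on_scaleR = smooth_on_bilinear[OF bounded_bilinear_scaleR]
lemmas smooth_on_inner = smooth_on_bilinear[OF bounded_bilinear_inner]

lemma smooth_on_linear: "bounded_linear L \<Longrightarrow> open U \<Longrightarrow> smooth_on U f \<Longrightarrow> smooth_on U (\<lambda>x. L (f x))"
  by (simp add: smooth_on_def C_k_on_linear)

lemma smooth_on_sum:
  "open U \<Longrightarrow> (\<And>i. i \<in> I \<Longrightarrow> smooth_on U (f i)) \<Longrightarrow> smooth_on U (\<lambda>x. \<Sum>i\<in>I. f i x)"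
  by (simp add: smooth_on_def C_k_on_sum)

lemma smooth_on_compose:
  fixes f :: "'b::euclidean_space \<Rightarrow> 'c::real_normed_vector"
    and p :: "'a::euclidean_space \<Rightarrow> 'b"
  assumes "open U" "p ` U \<subseteq> V" "smooth_on V f" "smooth_on U p"
  shows "smooth_on U (\<lambda>x. f (p x))"
  using assms C_k_on_compose[OF assms(1,2)] unfolding smooth_on_def by blast

lemma smooth_on_local:
  "(\<And>x. x \<in> U \<Longrightarrow> \<exists>V. open V \<and> x \<in> V \<and> smooth_on V f) \<Longrightarrow> smooth_on U f"
  unfolding smooth_on_def by (meson C_k_on_local)

lemma smooth_on_imp_differentiable: "smooth_on U f \<Longrightarrow> x \<in> U \<Longrightarrow> f differentiable (at x)"
  unfolding smooth_on_def by (metis C_k_on.simps(2))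

lemma smooth_on_frechet_derivative:
  "smooth_on U f \<Longrightarrow> smooth_on U (\<lambda>x. frechet_derivative f (at x) v)"
  unfolding smooth_on_def by (metis C_k_on.simps(2))

lemma smooth_on_frechet_derivative_apply:
  fixes f :: "'a::euclidean_space \<Rightarrow> 'b::real_normed_vector"
  assumes U: "open U" and f: "smooth_on U f" and h: "smooth_on U h"
  shows "smooth_on U (\<lambda>x. frechet_derivative f (at x) (h x))"
proof (rule smooth_on_cong[OF U])
  show "smooth_on U (\<lambda>x. \<Sum>i\<in>Basis. (h x \<bullet> i) *\<^sub>R frechet_derivative f (at x) i)"
    by (intro smooth_on_sum smooth_on_scaleR smooth_on_linear[OF bounded_linear_inner_left]
        smooth_on_frechet_derivative U f h)
  fix x assume "x \<in> U"
  then have "linear (frechet_derivative f (at x))"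
    using f smooth_on_imp_differentiable linear_frechet_derivative by blast
  then show "(\<Sum>i\<in>Basis. (h x \<bullet> i) *\<^sub>R frechet_derivative f (at x) i) =
      frechet_derivative f (at x) (h x)"
    by (rule linear_eq_sum_Basis[symmetric])
qed

section \<open>Bump functions\<close>

text \<open>The powers of 1/t in front of exp(-1/t) make the linear span of the family closed under
  differentiation, so that one induction proves all members smooth at once.\<close>

definition flat_exp :: "nat \<Rightarrow> real \<Rightarrow> real" where
  "flat_exp n t = (if t > 0 then (1/t) ^ n * exp (- (1/t)) else 0)"

lemma flat_exp_tendsto_0: "(flat_exp n \<longlongrightarrow> 0) (at 0)"
proof -
  have "((\<lambda>t::real. (1/t) ^ n * exp (- (1/t))) \<longlongrightarrow> 0) (at_right 0)"
  proof -
    have "((\<lambda>s::real. s ^ n * exp (- s)) \<longlongrightarrow> 0) at_top"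
      using tendsto_power_div_exp_0[of n] by (simp add: exp_minus field_simps)
    moreover have "filterlim (\<lambda>t::real. 1/t) at_top (at_right 0)"
      using filterlim_inverse_at_top_right by (simp add: inverse_eq_divide)
    ultimately show ?thesis by (rule filterlim_compose)
  qed
  then have "(flat_exp n \<longlongrightarrow> 0) (at_right 0)"
    by (rule Lim_transform_eventually) (auto simp: flat_exp_def eventually_at_right_field intro: gt_ex)
  moreover have "(flat_exp n \<longlongrightarrow> 0) (at_left 0)"
    by (rule Lim_transform_eventually[OF tendsto_const])
       (auto simp: flat_exp_def eventually_at_left_field intro: lt_ex)
  ultimately show ?thesis by (simp add: filterlim_split_at_real)
qed

lemma flat_exp_has_derivative:
  "(flat_exp n has_real_derivative flat_exp (n+2) t - n * flat_exp (n+1) t) (at t)"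
proof -
  consider "t > 0" | "t < 0" | "t = 0" by linarith
  then show ?thesis
  proof cases
    case 1
    have "((\<lambda>t. (1/t) ^ n * exp (- (1/t))) has_real_derivative
        flat_exp (n+2) t - n * flat_exp (n+1) t) (at t)"
    proof -
      have d: "((\<lambda>t. 1/t) has_real_derivative - ((1/t) * (1/t))) (at t)"
        using 1 by (auto intro!: derivative_eq_intros)
      have p: "((\<lambda>t. (1/t) ^ n) has_real_derivative - (n * (1/t) ^ (n+1))) (at t)"
        by (rule DERIV_cong[OF DERIV_power[OF d]]) (cases n; simp)
      have e: "((\<lambda>t. exp (- (1/t))) has_real_derivative exp (- (1/t)) * ((1/t) * (1/t))) (at t)"
        by (rule DERIV_cong[OF DERIV_fun_exp[OF DERIV_minus[OF d]]]) simp
      show ?thesis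
        by (rule DERIV_cong[OF DERIV_mult[OF p e]]) (use 1 in \<open>simp add: flat_exp_def mult_ac\<close>)
    qed
    then show ?thesis
      by (rule has_field_derivative_transform_within_open[of _ _ _ "{0<..}"])
        (use 1 in \<open>auto simp: flat_exp_def\<close>)
  next
    case 2
    have "((\<lambda>t. 0) has_real_derivative flat_exp (n+2) t - n * flat_exp (n+1) t) (at t)"
      using 2 by (auto simp: flat_exp_def)
    then show ?thesis
      by (rule has_field_derivative_transform_within_open[of _ _ _ "{..<0}"])
        (use 2 in \<open>auto simp: flat_exp_def\<close>)
  next
    case 3
    \<comment> \<open>At the origin the difference quotient of \<open>flat_exp n\<close> is
      \<open>flat_exp (n+1)\<close>, whose limit is known.\<close>
    have "((\<lambda>h. (flat_exp n (0 + h) - flat_exp n 0) / h) \<longlongrightarrow> 0) (at 0)"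
      by (rule Lim_transform_eventually[OF flat_exp_tendsto_0[of "n+1"]])
         (auto simp: flat_exp_def eventually_at_filter)
    then show ?thesis
      using 3 by (simp add: DERIV_def flat_exp_def)
  qed
qed

lemma smooth_on_flat_exp: "smooth_on UNIV (flat_exp n)"
proof -
  have "C_k_on k (flat_exp n) UNIV" for k
  proof (induction k arbitrary: n)
    case 0
    then show ?case
      using flat_exp_has_derivative DERIV_isCont
      by (fastforce simp: continuous_on_eq_continuous_at)
  next
    case (Suc k)
    show ?case
    proof (rule C_k_on_SucI[OF open_UNIV])
      show "(flat_exp n has_derivative (\<lambda>v. (flat_exp (n+2) t + (- real n) * flat_exp (n+1) t) * v)) (at t)" for t
        using flat_exp_has_derivative[of n t] by (simp add: has_field_derivative_def)
      show "C_k_on k (\<lambda>t. (flat_exp (n+2) t + (- real n) * flat_exp (n+1) t) * v) UNIV" for v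
        by (intro C_k_on_bilinear[OF bounded_bilinear_mult] C_k_on_add Suc C_k_on_const open_UNIV)
    qed
  qed
  then show ?thesis by (simp add: smooth_on_def)
qed

text \<open>The function r^2 - |u - a|^2 is positive exactly on the open ball, and
  \<open>flat_exp 0\<close> cuts it off smoothly at zero. Division by the value at the centre
  normalises.\<close>

lemma smooth_bump_exists:
  fixes a :: "'a::euclidean_space"
  assumes "r > 0"
  obtains b :: "'a \<Rightarrow> real" where "smooth_on UNIV b" "b a = 1" "\<And>u. u \<notin> cball a r \<Longrightarrow> b u = 0"
proof
  let ?q = "\<lambda>u. r\<^sup>2 + (-1) * ((u + - a) \<bullet> (u + - a))"
  let ?b = "\<lambda>u. flat_exp 0 (?q u) * (1 / flat_exp 0 (r\<^sup>2))"
  have "smooth_on UNIV ?q"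
    by (intro smooth_on_add smooth_on_mult smooth_on_inner smooth_on_const smooth_on_ident open_UNIV)
  then show "smooth_on UNIV ?b"
    by (intro smooth_on_mult smooth_on_const open_UNIV smooth_on_compose[OF _ _ smooth_on_flat_exp]) auto
  show "?b a = 1" using assms by (simp add: flat_exp_def)
  fix u assume "u \<notin> cball a r"
  then have "r < norm (u - a)" by (simp add: dist_norm norm_minus_commute)
  then have "r\<^sup>2 < (norm (u - a))\<^sup>2"
    using assms by (intro power_strict_mono) auto
  then show "?b u = 0" by (simp add: flat_exp_def power2_norm_eq_inner)
qed

section \<open>Transition maps and localisation\<close>

lemma chart_inv_left: "is_chart c \<Longrightarrow> y \<in> fst c \<Longrightarrow> chart_inv c (snd c y) = y"
  unfolding is_chart_def using homeomorphism_apply1 by blast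

lemma chart_inv_mem: "is_chart c \<Longrightarrow> u \<in> snd c ` fst c \<Longrightarrow> chart_inv c u \<in> fst c"
  using chart_inv_left by fastforce

lemma open_chart_image: "is_chart c \<Longrightarrow> open W \<Longrightarrow> open (snd c ` (fst c \<inter> W))"
  unfolding is_chart_def
  by (metis homeomorphism_imp_open_map openin_open_eq openin_open_Int)

locale oriented_manifold =
  fixes A :: "'m::t2_space chart set"
  assumes atlas: "oriented_atlas A"
begin

lemma chart: "c \<in> A \<Longrightarrow> is_chart c"
  using atlas by (simp add: oriented_atlas_def)

lemma chart_at_mem: "chart_at A x \<in> A" "x \<in> fst (chart_at A x)"
proof -
  have "\<exists>c. c \<in> A \<and> x \<in> fst c" using atlas unfolding oriented_atlas_def by blast
  then show "chart_at A x \<in> A" "x \<in> fst (chart_at A x)"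
    unfolding chart_at_def by (metis (mono_tags, lifting) someI_ex)+
qed

lemma open_chart_domain: "c \<in> A \<Longrightarrow> open (fst c)"
  using chart by (simp add: is_chart_def)

lemma open_overlap: "c \<in> A \<Longrightarrow> d \<in> A \<Longrightarrow> open (snd c ` (fst c \<inter> fst d))"
  using open_chart_image chart open_chart_domain by blast

lemma open_chart_range: "c \<in> A \<Longrightarrow> open (snd c ` fst c)"
  using chart by (simp add: is_chart_def)

lemma smooth_transition:
  "c \<in> A \<Longrightarrow> d \<in> A \<Longrightarrow> smooth_on (snd c ` (fst c \<inter> fst d)) (transition c d)"
  using atlas by (simp add: oriented_atlas_def)

lemma transition_apply: "c \<in> A \<Longrightarrow> y \<in> fst c \<Longrightarrow> transition c d (snd c y) = snd d y"
  using chart chart_inv_left by (fastforce simp: transition_def)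

definition jac :: "'m chart \<Rightarrow> 'm chart \<Rightarrow> 'm \<Rightarrow> real^4 \<Rightarrow> real^4" where
  "jac c d y = frechet_derivative (transition c d) (at (snd c y))"

lemma coord_eq_jac: "coord A c x = jac (chart_at A x) c x"
  by (simp add: coord_def jac_def fun_eq_iff)

lemma transition_differentiable:
  "c \<in> A \<Longrightarrow> d \<in> A \<Longrightarrow> y \<in> fst c \<Longrightarrow> y \<in> fst d \<Longrightarrow> transition c d differentiable (at (snd c y))"
  by (rule smooth_on_imp_differentiable[OF smooth_transition]) auto

lemma linear_jac: "c \<in> A \<Longrightarrow> d \<in> A \<Longrightarrow> y \<in> fst c \<Longrightarrow> y \<in> fst d \<Longrightarrow> linear (jac c d y)"
  unfolding jac_def using transition_differentiable linear_frechet_derivative by blast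

text \<open>This is the chain rule for transition maps. The composition law holds on the overlap of
  \<open>c\<close> and \<open>d\<close>, whose openness lets the derivatives be compared.\<close>

lemma jac_jac:
  assumes "c \<in> A" "d \<in> A" "e \<in> A" "y \<in> fst c" "y \<in> fst d" "y \<in> fst e"
  shows "jac d e y (jac c d y v) = jac c e y v"
proof -
  have "frechet_derivative (transition d e \<circ> transition c d) (at (snd c y)) = jac d e y \<circ> jac c d y"
    unfolding jac_def
    by (subst frechet_derivative_compose) (use assms transition_apply transition_differentiable in auto)
  moreover have "frechet_derivative (transition c e) (at (snd c y)) =
      frechet_derivative (transition d e \<circ> transition c d) (at (snd c y))"
    by (rule frechet_derivative_transform_within_open[of _ _ "snd c ` (fst c \<inter> fst d)"])
       (use assms transition_apply[OF assms(1), of _ d] transition_apply[OF assms(1), of _ e]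
         transition_apply[OF assms(2), of _ e] transition_differentiable open_overlap in auto)
  ultimately show ?thesis by (simp add: jac_def)
qed

lemma jac_same:
  assumes "c \<in> A" "y \<in> fst c"
  shows "jac c c y v = v"
proof -
  have "frechet_derivative (\<lambda>u. u) (at (snd c y)) = frechet_derivative (transition c c) (at (snd c y))"
    by (rule frechet_derivative_transform_within_open[of _ _ "snd c ` fst c"])
       (use assms(2) transition_apply[OF assms(1), of _ c] open_chart_range[OF assms(1)] in auto)
  then show ?thesis by (simp add: jac_def fun_eq_iff)
qed

lemma linear_coord: "c \<in> A \<Longrightarrow> y \<in> fst c \<Longrightarrow> linear (coord A c y)"
  unfolding coord_eq_jac using linear_jac chart_at_mem by blast

lemma smooth_fun_add: "smooth_fun A f \<Longrightarrow> smooth_fun A h \<Longrightarrow> smooth_fun A (\<lambda>y. f y + h y)"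
  unfolding smooth_fun_def comp_def using smooth_on_add open_chart_range by blast

lemma smooth_fun_mult: "smooth_fun A f \<Longrightarrow> smooth_fun A h \<Longrightarrow> smooth_fun A (\<lambda>y. f y * h y)"
  unfolding smooth_fun_def comp_def using smooth_on_mult open_chart_range by blast

lemma smooth_fun_const: "smooth_fun A (\<lambda>y. k)"
  by (simp add: smooth_fun_def comp_def smooth_on_const)

lemma smooth_fun_diff: "smooth_fun A f \<Longrightarrow> smooth_fun A h \<Longrightarrow> smooth_fun A (\<lambda>y. f y - h y)"
  using smooth_fun_add[of f "\<lambda>y. -1 * h y"] smooth_fun_mult[OF smooth_fun_const, of h "-1"] by simp

lemma smooth_vfield_add:
  assumes "smooth_vfield A X" "smooth_vfield A Y"
  shows "smooth_vfield A (\<lambda>y. X y + Y y)"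
  unfolding smooth_vfield_def
proof
  fix c assume c: "c \<in> A"
  show "smooth_on (snd c ` fst c) (local_rep A c (\<lambda>y. X y + Y y))"
  proof (rule smooth_on_cong[OF open_chart_range[OF c]])
    show "smooth_on (snd c ` fst c) (\<lambda>u. local_rep A c X u + local_rep A c Y u)"
      using assms c by (intro smooth_on_add open_chart_range) (auto simp: smooth_vfield_def)
    show "local_rep A c X u + local_rep A c Y u = local_rep A c (\<lambda>y. X y + Y y) u"
      if "u \<in> snd c ` fst c" for u
      using linear_add[OF linear_coord[OF c chart_inv_mem[OF chart[OF c] that]]] by (simp add: local_rep_def)
  qed
qed

lemma smooth_vfield_scaleR:
  assumes "smooth_fun A f" "smooth_vfield A X"
  shows "smooth_vfield A (\<lambda>y. f y *\<^sub>R X y)"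
  unfolding smooth_vfield_def
proof
  fix c assume c: "c \<in> A"
  show "smooth_on (snd c ` fst c) (local_rep A c (\<lambda>y. f y *\<^sub>R X y))"
  proof (rule smooth_on_cong[OF open_chart_range[OF c]])
    show "smooth_on (snd c ` fst c) (\<lambda>u. (f \<circ> chart_inv c) u *\<^sub>R local_rep A c X u)"
      using assms c
      by (intro smooth_on_scaleR open_chart_range) (simp_all add: smooth_vfield_def smooth_fun_def comp_def)
    show "(f \<circ> chart_inv c) u *\<^sub>R local_rep A c X u = local_rep A c (\<lambda>y. f y *\<^sub>R X y) u"
      if "u \<in> snd c ` fst c" for u
      using linear_cmul[OF linear_coord[OF c chart_inv_mem[OF chart[OF c] that]]] by (simp add: local_rep_def)
  qed
qed

lemmas smooth_vfield_cmul = smooth_vfield_scaleR[OF smooth_fun_const]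

lemma smooth_vfield_diff:
  "smooth_vfield A X \<Longrightarrow> smooth_vfield A Y \<Longrightarrow> smooth_vfield A (\<lambda>y. X y - Y y)"
  using smooth_vfield_add[of X "\<lambda>y. -1 *\<^sub>R Y y"] smooth_vfield_cmul[of Y "-1"] by simp

section \<open>Extension by zero of functions and fields given in one chart\<close>

definition fun_ext :: "'m chart \<Rightarrow> (real^4 \<Rightarrow> real) \<Rightarrow> 'm \<Rightarrow> real" where
  "fun_ext c h y = (if y \<in> fst c then h (snd c y) else 0)"

text \<open>A field stores at \<open>y\<close> its components in \<open>chart_at A y\<close>, which
  may jump from point to point. Components given in \<open>c\<close> must therefore be carried over
  by \<open>jac\<close> at every point.\<close>

definition vfield_ext :: "'m chart \<Rightarrow> (real^4 \<Rightarrow> real^4) \<Rightarrow> 'm vfield" where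
  "vfield_ext c h y = (if y \<in> fst c then jac c (chart_at A y) y (h (snd c y)) else 0)"

lemma smooth_on_extension:
  fixes F :: "'m \<Rightarrow> 'b::real_normed_vector"
  assumes cd: "c \<in> A" "d \<in> A" and K: "compact K" "K \<subseteq> snd c ` fst c"
    and F: "smooth_on (snd d ` (fst d \<inter> fst c)) (\<lambda>u. F (chart_inv d u))"
    and F0: "\<And>y. y \<notin> chart_inv c ` K \<Longrightarrow> F y = 0"
  shows "smooth_on (snd d ` fst d) (\<lambda>u. F (chart_inv d u))"
proof (rule smooth_on_local)
  fix u assume "u \<in> snd d ` fst d"
  then obtain y where y: "y \<in> fst d" "u = snd d y" by auto
  show "\<exists>V. open V \<and> u \<in> V \<and> smooth_on V (\<lambda>u. F (chart_inv d u))"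
  proof (cases "y \<in> fst c")
    case True
    then show ?thesis using y F open_overlap[OF cd(2,1)] by blast
  next
    case False
    have "continuous_on K (chart_inv c)"
      using chart[OF cd(1)] K(2) unfolding is_chart_def
      by (meson continuous_on_subset homeomorphism_cont2)
    \<comment> \<open>The Hausdorff property enters here: the compact image of \<open>K\<close> is
      closed, so \<open>F\<close> vanishes near every point outside the domain of
      \<open>c\<close>.\<close>
    then have "closed (chart_inv c ` K)"
      using K(1) compact_continuous_image compact_imp_closed by blast
    then have V: "open (snd d ` (fst d \<inter> - (chart_inv c ` K)))"
      by (intro open_chart_image chart cd) auto
    have "chart_inv c ` K \<subseteq> fst c"
      using K(2) chart_inv_mem[OF chart[OF cd(1)]] by blast
    with False y have "u \<in> snd d ` (fst d \<inter> - (chart_inv c ` K))" by blast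
    moreover have "smooth_on (snd d ` (fst d \<inter> - (chart_inv c ` K))) (\<lambda>u. F (chart_inv d u))"
      by (rule smooth_on_cong[OF V _ smooth_on_const[of _ 0]])
         (use chart_inv_left[OF chart[OF cd(2)]] F0 in auto)
    ultimately show ?thesis using V by blast
  qed
qed

lemma smooth_transition_compose:
  fixes h :: "real^4 \<Rightarrow> 'b::real_normed_vector"
  assumes "c \<in> A" "d \<in> A" "smooth_on (snd c ` (fst c \<inter> fst d)) h"
  shows "smooth_on (snd d ` (fst d \<inter> fst c)) (\<lambda>u. h (transition d c u))"
  by (rule smooth_on_compose[OF _ _ assms(3) smooth_transition])
     (use assms open_overlap transition_apply[OF assms(2), of _ c] in auto)

lemma smooth_fun_ext:
  assumes c: "c \<in> A" and K: "compact K" "K \<subseteq> snd c ` fst c"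
    and h: "smooth_on (snd c ` fst c) h" and h0: "\<And>u. u \<notin> K \<Longrightarrow> h u = 0"
  shows "smooth_fun A (fun_ext c h)"
  unfolding smooth_fun_def comp_def
proof
  fix d assume d: "d \<in> A"
  show "smooth_on (snd d ` fst d) (\<lambda>u. fun_ext c h (chart_inv d u))"
  proof (rule smooth_on_extension[OF c d K])
    show "smooth_on (snd d ` (fst d \<inter> fst c)) (\<lambda>u. fun_ext c h (chart_inv d u))"
    proof (rule smooth_on_cong[OF open_overlap[OF d c]])
      show "smooth_on (snd d ` (fst d \<inter> fst c)) (\<lambda>u. h (transition d c u))"
        by (intro smooth_transition_compose c d smooth_on_subset[OF h]) auto
    qed (auto simp: fun_ext_def transition_apply[OF d] chart_inv_left[OF chart[OF d]])
    show "fun_ext c h y = 0" if "y \<notin> chart_inv c ` K" for y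
    proof (cases "y \<in> fst c")
      case True
      then have "snd c y \<notin> K" using that chart_inv_left[OF chart[OF c]] by force
      then show ?thesis using h0 by (simp add: fun_ext_def)
    qed (simp add: fun_ext_def)
  qed
qed

lemma smooth_vfield_ext:
  assumes c: "c \<in> A" and K: "compact K" "K \<subseteq> snd c ` fst c"
    and h: "smooth_on (snd c ` fst c) h" and h0: "\<And>u. u \<notin> K \<Longrightarrow> h u = 0"
  shows "smooth_vfield A (vfield_ext c h)"
  unfolding smooth_vfield_def local_rep_def
proof
  fix d assume d: "d \<in> A"
  show "smooth_on (snd d ` fst d) (\<lambda>u. coord A d (chart_inv d u) (vfield_ext c h (chart_inv d u)))"
  proof (cases "fst d = {}")
    case True
    then show ?thesis by (auto intro: smooth_on_local)
  next
    case False
    let ?F = "\<lambda>y. if y \<in> fst c \<inter> fst d then jac c d y (h (snd c y)) else 0"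
    \<comment> \<open>Passing from \<open>c\<close> to the preferred chart and on to
      \<open>d\<close> is the same as passing from \<open>c\<close> to \<open>d\<close>. The erratic
      choice of \<open>chart_at\<close> drops out and only smooth transition maps remain.\<close>
    have eq: "coord A d y (vfield_ext c h y) = ?F y" if y: "y \<in> fst d" for y
      using linear_0[OF linear_coord[OF d y]] jac_jac[OF c _ d, of "chart_at A y" y] chart_at_mem y
      by (simp add: vfield_ext_def coord_eq_jac)
    have "smooth_on (snd d ` fst d) (\<lambda>u. ?F (chart_inv d u))"
    proof (rule smooth_on_extension[OF c d K])
      show "smooth_on (snd d ` (fst d \<inter> fst c)) (\<lambda>u. ?F (chart_inv d u))"
      proof (rule smooth_on_cong[OF open_overlap[OF d c]])
        show "smooth_on (snd d ` (fst d \<inter> fst c)) (\<lambda>u. (\<lambda>w. frechet_derivative (transition c d) (at w) (h w)) (transition d c u))"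
          by (intro smooth_transition_compose c d smooth_on_frechet_derivative_apply
              open_overlap smooth_transition smooth_on_subset[OF h]) auto
      qed (auto simp: jac_def transition_apply[OF d] chart_inv_left[OF chart[OF d]])
      show "?F y = 0" if "y \<notin> chart_inv c ` K" for y
      proof (cases "y \<in> fst c \<inter> fst d")
        case True
        then have "snd c y \<notin> K" using that chart_inv_left[OF chart[OF c]] by force
        then show ?thesis using h0 linear_0[OF linear_jac[OF c d]] True by simp
      next
        case False
        then show ?thesis by auto
      qed
    qed
    then show ?thesis
      by (rule smooth_on_cong[OF open_chart_range[OF d], rotated])
         (auto simp: eq chart_inv_left[OF chart[OF d]])
  qed
qed

lemma chart_bump:
  assumes "c \<in> A" "x \<in> fst c"
  obtains b :: "real^4 \<Rightarrow> real" and K where "compact K" "K \<subseteq> snd c ` fst c" "smooth_on UNIV b" "b (snd c x) = 1"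
    "\<And>u. u \<notin> K \<Longrightarrow> b u = 0"
proof -
  obtain r where r: "r > 0" "cball (snd c x) r \<subseteq> snd c ` fst c"
    using open_chart_range[OF assms(1)] assms(2) open_contains_cball by (metis imageI)
  obtain b :: "real^4 \<Rightarrow> real" where "smooth_on UNIV b" "b (snd c x) = 1" "\<And>u. u \<notin> cball (snd c x) r \<Longrightarrow> b u = 0"
    using smooth_bump_exists[OF r(1)] by blast
  then show ?thesis using r(2) by (intro that[of "cball (snd c x) r" b]) auto
qed

text \<open>A constant coordinate field times a bump function does this. The lemma makes the choice
  in \<open>extend\<close> meaningful.\<close>

lemma vfield_through: "\<exists>X. smooth_vfield A X \<and> X x = v"
proof -
  let ?c = "chart_at A x"
  obtain b :: "real^4 \<Rightarrow> real" and K where K: "compact K" "K \<subseteq> snd ?c ` fst ?c"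
    and b: "smooth_on UNIV b" "b (snd ?c x) = 1" "\<And>u. u \<notin> K \<Longrightarrow> b u = 0"
    by (rule chart_bump[OF chart_at_mem[of x]]) blast
  have "smooth_vfield A (vfield_ext ?c (\<lambda>u. b u *\<^sub>R v))"
    by (rule smooth_vfield_ext[OF chart_at_mem(1) K smooth_on_scaleR])
       (simp_all add: open_chart_range chart_at_mem smooth_on_subset[OF b(1)] smooth_on_const b(3))
  moreover have "vfield_ext ?c (\<lambda>u. b u *\<^sub>R v) x = v"
    using jac_same[OF chart_at_mem] chart_at_mem b(2) by (simp add: vfield_ext_def)
  ultimately show ?thesis by blast
qed

lemma extend: "smooth_vfield A (extend A x v)" "extend A x v x = v"
  unfolding extend_def using someI_ex[OF vfield_through[of x v]] by blast+

text \<open>Neither the components of \<open>X\<close> in a chart nor the coordinate fields are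
  global. Each receives one factor \<open>b\<close> and is then extended by zero, which is the
  origin of the product \<open>b y * b y\<close>.\<close>

lemma local_decomposition:
  assumes X: "smooth_vfield A X"
  obtains b :: "'m \<Rightarrow> real" and E :: "4 \<Rightarrow> 'm vfield" and f :: "4 \<Rightarrow> 'm \<Rightarrow> real"
  where "smooth_fun A b" "b x = 1" "\<And>i. smooth_vfield A (E i)" "\<And>i. smooth_fun A (f i)"
    "\<And>y. (b y * b y) *\<^sub>R X y = (\<Sum>i\<in>UNIV. f i y *\<^sub>R E i y)" "\<And>i. X x = 0 \<Longrightarrow> f i x = 0"
proof -
  let ?c = "chart_at A x"
  note c = chart_at_mem[of x]
  obtain b :: "real^4 \<Rightarrow> real" and K where K: "compact K" "K \<subseteq> snd ?c ` fst ?c"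
    and b: "smooth_on UNIV b" "b (snd ?c x) = 1" "\<And>u. u \<notin> K \<Longrightarrow> b u = 0"
    by (rule chart_bump[OF chart_at_mem[of x]]) blast
  note b' = smooth_on_subset[OF b(1) subset_UNIV, of "snd ?c ` fst ?c"]
  let ?B = "fun_ext ?c b"
  let ?E = "\<lambda>i. vfield_ext ?c (\<lambda>u. b u *\<^sub>R axis i 1)"
  let ?f = "\<lambda>i. fun_ext ?c (\<lambda>u. b u * local_rep A ?c X u $ i)"
  have X': "smooth_on (snd ?c ` fst ?c) (local_rep A ?c X)"
    using X c by (auto simp: smooth_vfield_def)
  have "smooth_fun A ?B" by (rule smooth_fun_ext[OF c(1) K b' b(3)])
  moreover have "?B x = 1" using b c by (simp add: fun_ext_def)
  moreover have "smooth_vfield A (?E i)" for i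
    by (rule smooth_vfield_ext[OF c(1) K smooth_on_scaleR])
       (simp_all add: open_chart_range c b' smooth_on_const b(3))
  moreover have "smooth_fun A (?f i)" for i
    by (rule smooth_fun_ext[OF c(1) K smooth_on_mult])
       (simp_all add: open_chart_range c b' smooth_on_linear[OF bounded_linear_vec_nth] X' b(3))
  moreover have "(?B y * ?B y) *\<^sub>R X y = (\<Sum>i\<in>UNIV. ?f i y *\<^sub>R ?E i y)" for y
  proof (cases "y \<in> fst ?c")
    case True
    let ?w = "coord A ?c y (X y)" and ?L = "jac ?c (chart_at A y) y"
    have L: "linear ?L" using True c chart_at_mem by (intro linear_jac) auto
    have "?L ?w = X y"
      using True c chart_at_mem[of y] by (simp add: coord_eq_jac jac_jac jac_same)
    moreover have "?w = (\<Sum>i\<in>UNIV. (?w $ i) *\<^sub>R axis i 1)"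
      using basis_expansion[of ?w] by (simp add: scalar_mult_eq_scaleR)
    ultimately have "X y = ?L (\<Sum>i\<in>UNIV. (?w $ i) *\<^sub>R axis i 1)" by simp
    also have "\<dots> = (\<Sum>i\<in>UNIV. (?w $ i) *\<^sub>R ?L (axis i 1))"
      by (simp add: linear_sum[OF L] linear_cmul[OF L])
    finally have *: "X y = (\<Sum>i\<in>UNIV. (?w $ i) *\<^sub>R ?L (axis i 1))" .
    show ?thesis
      using True chart_inv_left[OF chart[OF c(1)] True]
      by (subst *) (simp add: fun_ext_def vfield_ext_def local_rep_def linear_cmul[OF L]
          scaleR_sum_right mult_ac)
  qed (simp add: fun_ext_def)
  moreover have "?f i x = 0" if "X x = 0" for i
    using that linear_0[OF linear_coord[OF c]] chart_inv_left[OF chart[OF c(1)] c(2)]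
    by (simp add: fun_ext_def local_rep_def)
  ultimately show ?thesis by (rule that)
qed

section \<open>Operators that depend only on the value of a field at a point\<close>

definition tensorial_at :: "'m \<Rightarrow> ('m vfield \<Rightarrow> 'b::real_vector) \<Rightarrow> bool" where
  "tensorial_at x L \<longleftrightarrow>
    (\<forall>X Y. smooth_vfield A X \<longrightarrow> smooth_vfield A Y \<longrightarrow> L (\<lambda>y. X y + Y y) = L X + L Y) \<and>
    (\<forall>f X. smooth_fun A f \<longrightarrow> smooth_vfield A X \<longrightarrow> L (\<lambda>y. f y *\<^sub>R X y) = f x *\<^sub>R L X)"

lemma tensorial_at_add:
  "tensorial_at x L \<Longrightarrow> smooth_vfield A X \<Longrightarrow> smooth_vfield A Y \<Longrightarrow> L (\<lambda>y. X y + Y y) = L X + L Y"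
  by (simp add: tensorial_at_def)

lemma tensorial_at_scaleR:
  "tensorial_at x L \<Longrightarrow> smooth_fun A f \<Longrightarrow> smooth_vfield A X \<Longrightarrow> L (\<lambda>y. f y *\<^sub>R X y) = f x *\<^sub>R L X"
  by (simp add: tensorial_at_def)

lemma tensorial_at_sum:
  assumes L: "tensorial_at x L" and "finite I" "\<And>i. smooth_vfield A (X i)"
  shows "smooth_vfield A (\<lambda>y. \<Sum>i\<in>I. X i y) \<and> L (\<lambda>y. \<Sum>i\<in>I. X i y) = (\<Sum>i\<in>I. L (X i))"
  using assms(2)
proof induction
  case empty
  show ?case
    using smooth_vfield_cmul[OF extend(1), of 0 x 0]
      tensorial_at_scaleR[OF L smooth_fun_const[of 0] extend(1)[of x 0]] by simp
next
  case (insert i I)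
  then show ?case
    using smooth_vfield_add[OF assms(3)[of i], of "\<lambda>y. \<Sum>i\<in>I. X i y"]
      tensorial_at_add[OF L assms(3)[of i], of "\<lambda>y. \<Sum>i\<in>I. X i y"] by simp
qed

text \<open>Multiplying \<open>X\<close> by the square of a bump function makes its chart expansion global, so that
  no locality property of \<open>L\<close> is required.\<close>

lemma tensorial_at_zero:
  assumes L: "tensorial_at x L" and X: "smooth_vfield A X" "X x = 0"
  shows "L X = 0"
proof -
  obtain b E f where *: "smooth_fun A b" "b x = 1" "\<And>i. smooth_vfield A (E i)" "\<And>i. smooth_fun A (f i)"
    "\<And>y. (b y * b y) *\<^sub>R X y = (\<Sum>i\<in>(UNIV::4 set). f i y *\<^sub>R E i y)" "\<And>i. X x = 0 \<Longrightarrow> f i x = 0"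
    by (rule local_decomposition[OF X(1), of x]) blast
  note fE = smooth_vfield_scaleR[OF *(4,3)]
  have "L X = L (\<lambda>y. (b y * b y) *\<^sub>R X y)"
    using tensorial_at_scaleR[OF L smooth_fun_mult[OF *(1,1)] X(1)] *(2) by simp
  also have "\<dots> = (\<Sum>i\<in>UNIV. L (\<lambda>y. f i y *\<^sub>R E i y))"
    unfolding *(5) by (rule tensorial_at_sum[OF L finite fE, THEN conjunct2])
  also have "\<dots> = 0"
    using X(2) *(6) by (simp add: tensorial_at_scaleR[OF L *(4,3)])
  finally show ?thesis .
qed

lemma tensorial_at_cong:
  assumes L: "tensorial_at x L" and X: "smooth_vfield A X" and Y: "smooth_vfield A Y" and "X x = Y x"
  shows "L X = L Y"
proof -
  have "L (\<lambda>y. X y + -1 *\<^sub>R Y y) = 0"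
    by (rule tensorial_at_zero[OF L])
       (use assms smooth_vfield_add[OF X smooth_vfield_cmul[OF Y, of "-1"]] in auto)
  then show ?thesis
    using tensorial_at_add[OF L X smooth_vfield_cmul[OF Y, of "-1"]]
      tensorial_at_scaleR[OF L smooth_fun_const[of "-1"] Y] by simp
qed

lemma linear_tensorial_at:
  assumes L: "tensorial_at x L"
  shows "linear (\<lambda>v. L (extend A x v))"
proof (rule linearI)
  fix v w and k :: real
  have "L (extend A x (v + w)) = L (\<lambda>y. extend A x v y + extend A x w y)"
    by (rule tensorial_at_cong[OF L extend(1) smooth_vfield_add[OF extend(1) extend(1)]])
       (simp add: extend)
  then show "L (extend A x (v + w)) = L (extend A x v) + L (extend A x w)"
    by (simp add: tensorial_at_add[OF L extend(1) extend(1)])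
  have "L (extend A x (k *\<^sub>R v)) = L (\<lambda>y. k *\<^sub>R extend A x v y)"
    by (rule tensorial_at_cong[OF L extend(1) smooth_vfield_cmul[OF extend(1)]]) (simp add: extend)
  then show "L (extend A x (k *\<^sub>R v)) = k *\<^sub>R L (extend A x v)"
    by (simp add: tensorial_at_scaleR[OF L smooth_fun_const extend(1)])
qed

definition tensorial :: "'m conn \<Rightarrow> bool" where
  "tensorial T \<longleftrightarrow> (\<forall>x Z. smooth_vfield A Z \<longrightarrow>
     tensorial_at x (\<lambda>X. T X Z x) \<and> tensorial_at x (\<lambda>Y. T Z Y x))"

lemma tensorial_tensor_at:
  assumes "tensorial T" "smooth_vfield A X" "smooth_vfield A Y"
  shows "T X Y x = tensor_at A T x (X x) (Y x)"
proof -
  have "T X Y x = T (extend A x (X x)) Y x"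
    by (rule tensorial_at_cong[of x "\<lambda>X. T X Y x"]) (use assms in \<open>auto simp: tensorial_def extend\<close>)
  also have "\<dots> = T (extend A x (X x)) (extend A x (Y x)) x"
    by (rule tensorial_at_cong[of x "\<lambda>Y. T (extend A x (X x)) Y x"]) (use assms in \<open>auto simp: tensorial_def extend\<close>)
  finally show ?thesis by (simp add: tensor_at_def)
qed

lemma bilinear_tensor_at:
  assumes "tensorial T"
  shows "bilinear (tensor_at A T x)"
  unfolding bilinear_def tensor_at_def
  using assms linear_tensorial_at extend(1) by (fastforce simp: tensorial_def)

end

section \<open>Four-dimensional determinants\<close>

lemma vector_4 [simp]:
  "(vector [a, b, c, d] :: 'a::zero^4) $ 1 = a"
  "(vector [a, b, c, d] :: 'a::zero^4) $ 2 = b"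
  "(vector [a, b, c, d] :: 'a::zero^4) $ 3 = c"
  "(vector [a, b, c, d] :: 'a::zero^4) $ 4 = d"
  unfolding vector_def by simp_all

lemma det_4:
  "det (A :: 'a::comm_ring_1^4^4) =
    A$1$1 * (A$2$2 * A$3$3 * A$4$4 + A$2$3 * A$3$4 * A$4$2 + A$2$4 * A$3$2 * A$4$3
      - A$2$2 * A$3$4 * A$4$3 - A$2$3 * A$3$2 * A$4$4 - A$2$4 * A$3$3 * A$4$2)
  - A$1$2 * (A$2$1 * A$3$3 * A$4$4 + A$2$3 * A$3$4 * A$4$1 + A$2$4 * A$3$1 * A$4$3
      - A$2$1 * A$3$4 * A$4$3 - A$2$3 * A$3$1 * A$4$4 - A$2$4 * A$3$3 * A$4$1)
  + A$1$3 * (A$2$1 * A$3$2 * A$4$4 + A$2$2 * A$3$4 * A$4$1 + A$2$4 * A$3$1 * A$4$2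
      - A$2$1 * A$3$4 * A$4$2 - A$2$2 * A$3$1 * A$4$4 - A$2$4 * A$3$2 * A$4$1)
  - A$1$4 * (A$2$1 * A$3$2 * A$4$3 + A$2$2 * A$3$3 * A$4$1 + A$2$3 * A$3$1 * A$4$2
      - A$2$1 * A$3$3 * A$4$2 - A$2$2 * A$3$1 * A$4$3 - A$2$3 * A$3$2 * A$4$1)"
proof -
  have f: "finite {2::4, 3, 4}" "1 \<notin> {2::4, 3, 4}" "finite {3::4, 4}" "2 \<notin> {3::4, 4}"
    "finite {4::4}" "3 \<notin> {4::4}" by auto
  show ?thesis
    unfolding det_def UNIV_4
    unfolding sum_over_permutations_insert[OF f(1,2)]
    unfolding sum_over_permutations_insert[OF f(3,4)]
    unfolding sum_over_permutations_insert[OF f(5,6)]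
    unfolding permutes_sing
    by (simp add: sign_swap_id permutation_swap_id permutation_compose sign_compose sign_id swap_id_eq
        algebra_simps)
qed

section \<open>Orthonormal bases\<close>

lemma alternating_skew:
  fixes F :: "'a::real_vector \<Rightarrow> 'a \<Rightarrow> 'b::real_vector"
  assumes F: "bilinear F" and alt: "\<And>v. F v v = 0"
  shows "F v w = - F w v"
proof -
  have "F v v + F v w + (F w v + F w w) = 0"
    using alt[of "v + w"] by (simp only: bilinear_ladd[OF F] bilinear_radd[OF F] ac_simps)
  then show ?thesis by (simp add: alt eq_neg_iff_add_eq_0)
qed

locale euclidean_point =
  fixes g :: "'m form2" and x :: 'm
  assumes bil: "bilinear (g x)"
    and sym: "g x v w = g x w v"
    and pos: "v \<noteq> 0 \<Longrightarrow> g x v v > 0"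
begin

lemmas g_simps = bilinear_ladd[OF bil] bilinear_radd[OF bil] bilinear_lmul[OF bil] bilinear_rmul[OF bil]
  bilinear_lneg[OF bil] bilinear_rneg[OF bil] bilinear_lsub[OF bil] bilinear_rsub[OF bil]
  bilinear_lzero[OF bil] bilinear_rzero[OF bil]

lemma linear_g: "linear (g x v)" "linear (\<lambda>w. g x w v)"
  using bil by (auto simp: bilinear_def)

lemma g_sum: "g x v (\<Sum>i\<in>S. f i) = (\<Sum>i\<in>S. g x v (f i))" "g x (\<Sum>i\<in>S. f i) v = (\<Sum>i\<in>S. g x (f i) v)"
  using linear_sum[OF linear_g(1)] linear_sum[OF linear_g(2)] by auto

lemma onb_eq: "orthonormal_basis g x e \<Longrightarrow> g x (e i) (e j) = (if i = j then 1 else 0)"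
  by (simp add: orthonormal_basis_def)

text \<open>Orthonormality makes the four vectors independent, and four independent vectors span.
  Pairing an expansion with \<open>e j\<close> reads off its coefficients.\<close>

lemma onb_expand:
  assumes e: "orthonormal_basis g x e"
  shows "v = (\<Sum>i\<in>UNIV. g x v (e i) *\<^sub>R e i)"
proof -
  have inj: "inj e"
    by (rule injI) (metis e onb_eq zero_neq_one)
  have comb: "g x (\<Sum>i\<in>UNIV. c i *\<^sub>R e i) (e j) = c j" for c j
    by (simp add: g_sum g_simps onb_eq[OF e] if_distrib cong: if_cong)
  have "independent (range e)"
  proof (rule independent_if_scalars_zero)
    fix f w assume *: "(\<Sum>w\<in>range e. f w *\<^sub>R w) = 0" "w \<in> range e"
    then have "(\<Sum>i\<in>UNIV. f (e i) *\<^sub>R e i) = 0" by (simp add: sum.reindex[OF inj] o_def)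
    then have "f (e j) = 0" for j using comb[of "\<lambda>i. f (e i)" j] by (simp add: g_simps)
    then show "f w = 0" using *(2) by auto
  qed simp
  moreover have "card (range e) = dim (UNIV :: (real^4) set)"
    by (simp add: card_image[OF inj])
  ultimately have "v \<in> span (range e)"
    using card_eq_dim[of "range e" UNIV] by auto
  then obtain u where "v = (\<Sum>w\<in>range e. u w *\<^sub>R w)" by (auto simp: span_finite)
  then have v: "v = (\<Sum>i\<in>UNIV. u (e i) *\<^sub>R e i)" by (simp add: sum.reindex[OF inj] o_def)
  show ?thesis using comb[of "\<lambda>i. u (e i)"] v by simp
qed

lemma onb_eqI:
  assumes e: "orthonormal_basis g x e" and "\<And>i. g x v (e i) = g x w (e i)"
  shows "v = w"
  using onb_expand[OF e, of v] onb_expand[OF e, of w] assms(2) by simp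

lemma parseval:
  assumes e: "orthonormal_basis g x e"
  shows "g x v w = (\<Sum>i\<in>UNIV. g x v (e i) * g x w (e i))"
proof -
  have "g x v w = g x v (\<Sum>i\<in>UNIV. g x w (e i) *\<^sub>R e i)" using onb_expand[OF e, of w] by simp
  then show ?thesis by (simp add: g_sum g_simps mult.commute)
qed

text \<open>Expand one frame in the other and contract by Parseval. This lets frames fixed by a
  choice operator be exchanged for frames suited to \<open>J\<close>.\<close>

lemma onb_trace_eq:
  fixes F :: "real^4 \<Rightarrow> real^4 \<Rightarrow> 'b::real_vector"
  assumes F: "bilinear F" and e: "orthonormal_basis g x e" and f: "orthonormal_basis g x f"
  shows "(\<Sum>i\<in>UNIV. F (e i) (e i)) = (\<Sum>i\<in>UNIV. F (f i) (f i))"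
proof -
  have l: "linear (F v)" "linear (\<lambda>v. F v w)" for v w using F by (auto simp: bilinear_def)
  have "F (e i) (e i) = (\<Sum>j\<in>UNIV. \<Sum>k\<in>UNIV. (g x (f j) (e i) * g x (f k) (e i)) *\<^sub>R F (f j) (f k))" for i
  proof -
    have "F (e i) (e i) = F (\<Sum>j\<in>UNIV. g x (e i) (f j) *\<^sub>R f j) (\<Sum>k\<in>UNIV. g x (e i) (f k) *\<^sub>R f k)"
      using onb_expand[OF f, of "e i"] by simp
    also have "\<dots> = (\<Sum>j\<in>UNIV. \<Sum>k\<in>UNIV. (g x (e i) (f j) * g x (e i) (f k)) *\<^sub>R F (f j) (f k))"
      by (simp only: linear_sum[OF l(1)] linear_sum[OF l(2)] linear_cmul[OF l(1)] linear_cmul[OF l(2)]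
          scaleR_sum_right scaleR_scaleR) (subst sum.swap, simp only: mult.commute)
    finally show ?thesis by (simp add: sym)
  qed
  then have "(\<Sum>i\<in>UNIV. F (e i) (e i)) =
      (\<Sum>i\<in>UNIV. \<Sum>j\<in>UNIV. \<Sum>k\<in>UNIV. (g x (f j) (e i) * g x (f k) (e i)) *\<^sub>R F (f j) (f k))"
    by simp
  also have "\<dots> = (\<Sum>j\<in>UNIV. \<Sum>k\<in>UNIV. \<Sum>i\<in>UNIV. (g x (f j) (e i) * g x (f k) (e i)) *\<^sub>R F (f j) (f k))"
    (is "?L = ?R")
  proof -
    have "?L = (\<Sum>j\<in>UNIV. \<Sum>i\<in>UNIV. \<Sum>k\<in>UNIV. (g x (f j) (e i) * g x (f k) (e i)) *\<^sub>R F (f j) (f k))"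
      by (rule sum.swap)
    also have "\<dots> = ?R" by (intro sum.cong refl sum.swap)
    finally show ?thesis .
  qed
  also have "\<dots> = (\<Sum>j\<in>UNIV. \<Sum>k\<in>UNIV. g x (f j) (f k) *\<^sub>R F (f j) (f k))"
    by (simp add: scaleR_sum_left[symmetric] parseval[OF e, symmetric])
  also have "\<dots> = (\<Sum>i\<in>UNIV. F (f i) (f i))"
    by (simp add: onb_eq[OF f] if_distrib[of "\<lambda>r. r *\<^sub>R _"] cong: if_cong)
  finally show ?thesis .
qed

section \<open>The volume form and the Hodge star\<close>

definition comp :: "(4 \<Rightarrow> real^4) \<Rightarrow> real^4 \<Rightarrow> real^4" where
  "comp e v = (\<chi> i. g x (e i) v)"

lemma linear_comp: "linear (comp e)"
  by (rule linearI) (auto simp: comp_def vec_eq_iff g_simps)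

lemma det_comp:
  "det (vector [comp e a, comp e b, comp e c, comp e d] :: real^4^4) =
    det (vector [a, b, c, d] :: real^4^4) * det (matrix (comp e))"
proof -
  have "(vector [comp e a, comp e b, comp e c, comp e d] :: real^4^4) =
      vector [a, b, c, d] ** transpose (matrix (comp e))"
  proof -
    have *: "comp e v $ j = (\<Sum>k\<in>UNIV. v $ k * matrix (comp e) $ j $ k)" for v j
    proof -
      have "comp e v $ j = (matrix (comp e) *v v) $ j"
        by (simp add: matrix_works linear_comp)
      then show ?thesis by (simp add: matrix_vector_mult_def mult.commute)
    qed
    show ?thesis
      by (auto simp: vec_eq_iff forall_4 matrix_matrix_mult_def transpose_def *)
  qed
  then show ?thesis by (simp add: det_mul det_transpose)
qed

lemma det_comp_onb:
  assumes e: "orthonormal_basis g x e"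
  shows "det (vector [e 1, e 2, e 3, e 4] :: real^4^4) * det (matrix (comp e)) = 1"
proof -
  have "(vector [comp e (e 1), comp e (e 2), comp e (e 3), comp e (e 4)] :: real^4^4) = mat 1"
    by (auto simp: vec_eq_iff forall_4 mat_def comp_def onb_eq[OF e])
  then show ?thesis unfolding det_comp[symmetric] by simp
qed

text \<open>The matrix expressing \<open>f\<close> in the frame \<open>e\<close> is orthogonal, by
  Parseval for the pairs \<open>f i\<close>, \<open>f j\<close>.\<close>

lemma det_comp_pm:
  assumes e: "orthonormal_basis g x e" and f: "orthonormal_basis g x f"
  shows "det (vector [f 1, f 2, f 3, f 4] :: real^4^4) * det (matrix (comp e)) \<in> {1, -1}"
proof -
  let ?N = "vector [comp e (f 1), comp e (f 2), comp e (f 3), comp e (f 4)] :: real^4^4"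
  have N: "?N $ i = comp e (f i)" for i using exhaust_4[of i] by auto
  have "(?N ** transpose ?N) $ i $ j = mat 1 $ i $ j" for i j
  proof -
    have "(?N ** transpose ?N) $ i $ j = (\<Sum>k\<in>UNIV. g x (e k) (f i) * g x (e k) (f j))"
      by (simp only: matrix_matrix_mult_def transpose_def vec_lambda_beta N) (simp add: comp_def)
    also have "\<dots> = g x (f i) (f j)"
      by (simp only: sym[of "e k" "f i" for k] sym[of "e k" "f j" for k] parseval[OF e, symmetric])
    finally show ?thesis by (simp add: onb_eq[OF f] mat_def)
  qed
  then have "?N ** transpose ?N = mat 1" by (simp add: vec_eq_iff)
  then have "orthogonal_matrix (transpose ?N)"
    by (simp add: orthogonal_matrix)
  then have "det ?N \<in> {1, -1}" using det_orthogonal_matrix[of "transpose ?N"] by simp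
  then show ?thesis by (simp only: det_comp)
qed

text \<open>Two positive orthonormal frames differ by an orthogonal matrix of positive determinant,
  hence of determinant 1. The frame chosen inside \<open>volume_form\<close> may therefore be
  replaced by \<open>f\<close>.\<close>

lemma volume_form_onb:
  assumes f: "positive_orthonormal_basis g x f"
  shows "volume_form g x a b c d = det (vector [comp f a, comp f b, comp f c, comp f d] :: real^4^4)"
proof -
  define e where "e = (SOME e. positive_orthonormal_basis g x e)"
  have e: "positive_orthonormal_basis g x e" unfolding e_def by (rule someI[where P = "positive_orthonormal_basis g x", OF f])
  let ?De = "det (vector [e 1, e 2, e 3, e 4] :: real^4^4)"
    and ?Df = "det (vector [f 1, f 2, f 3, f 4] :: real^4^4)"
  have e': "orthonormal_basis g x e" "?De > 0" and f': "orthonormal_basis g x f" "?Df > 0"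
    using e f by (auto simp: positive_orthonormal_basis_def positively_oriented_def)
  have "det (matrix (comp e)) > 0"
    using det_comp_onb[OF e'(1)] e'(2) by (metis zero_less_mult_pos zero_less_one)
  then have "?Df * det (matrix (comp e)) > 0" using f'(2) by simp
  then have "?Df * det (matrix (comp e)) = 1" using det_comp_pm[OF e'(1) f'(1)] by auto
  then have "det (matrix (comp e)) = det (matrix (comp f))"
    using det_comp_onb[OF f'(1)] f'(2) by (metis mult_left_cancel less_irrefl)
  then have "det (vector [comp e a, comp e b, comp e c, comp e d] :: real^4^4) =
      det (vector [comp f a, comp f b, comp f c, comp f d] :: real^4^4)"
    by (simp only: det_comp)
  then show ?thesis
    unfolding volume_form_def Let_def e_def[symmetric] comp_def by simp
qed

text \<open>The double sum is a trace in each index separately. Independence of the frame is applied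
  to the second index and, after swapping the sums, to the first.\<close>

lemma hodge_star_onb:
  assumes f: "positive_orthonormal_basis g x f" and \<alpha>: "bilinear (\<alpha> x)"
  shows "hodge_star g \<alpha> x v w =
    1/2 * (\<Sum>j\<in>UNIV. \<Sum>k\<in>UNIV. \<alpha> x (f j) (f k) * volume_form g x (f j) (f k) v w)"
proof -
  define e where "e = (SOME e. orthonormal_basis g x e)"
  have f': "orthonormal_basis g x f" using f by (simp add: positive_orthonormal_basis_def)
  have e: "orthonormal_basis g x e" unfolding e_def by (rule someI[where P = "orthonormal_basis g x", OF f'])
  note l = linear_add[OF linear_comp] linear_cmul[OF linear_comp]
  note \<alpha>' = bilinear_ladd[OF \<alpha>] bilinear_radd[OF \<alpha>] bilinear_lmul[OF \<alpha>] bilinear_rmul[OF \<alpha>]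
  let ?V = "\<lambda>a b. volume_form g x a b v w"
  have V: "linear (?V a)" "linear (\<lambda>a. ?V a b)" for a b
    by (rule linearI; simp add: volume_form_onb[OF f] det_4 l algebra_simps)+
  have V': "?V (a + a') b = ?V a b + ?V a' b" "?V a (b + b') = ?V a b + ?V a b'"
    "?V (r *\<^sub>R a) b = r * ?V a b" "?V a (r *\<^sub>R b) = r * ?V a b" for a a' b b' r
    using linear_add[OF V(1)] linear_add[OF V(2)] linear_cmul[OF V(1)] linear_cmul[OF V(2)] by auto
  have 1: "bilinear (\<lambda>a b. \<alpha> x a c * ?V b c')" and 2: "bilinear (\<lambda>a b. \<alpha> x c a * ?V c' b)" for c c'
    unfolding bilinear_def by (auto intro!: linearI simp: \<alpha>' V' algebra_simps)
  have "(\<Sum>j\<in>UNIV. \<Sum>k\<in>UNIV. \<alpha> x (e j) (e k) * ?V (e j) (e k)) =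
    (\<Sum>j\<in>UNIV. \<Sum>k\<in>UNIV. \<alpha> x (e j) (f k) * ?V (e j) (f k))"
    by (intro sum.cong refl onb_trace_eq[OF 2 e f'])
  also have "\<dots> = (\<Sum>k\<in>UNIV. \<Sum>j\<in>UNIV. \<alpha> x (e j) (f k) * ?V (e j) (f k))"
    by (rule sum.swap)
  also have "\<dots> = (\<Sum>k\<in>UNIV. \<Sum>j\<in>UNIV. \<alpha> x (f j) (f k) * ?V (f j) (f k))"
    by (intro sum.cong refl onb_trace_eq[OF 1 e f'])
  also have "\<dots> = (\<Sum>j\<in>UNIV. \<Sum>k\<in>UNIV. \<alpha> x (f j) (f k) * ?V (f j) (f k))"
    by (rule sum.swap)
  finally show ?thesis unfolding hodge_star_def Let_def e_def[symmetric] by simp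
qed

lemma hodge_star_frame:
  assumes f: "positive_orthonormal_basis g x f" and \<alpha>: "bilinear (\<alpha> x)" and alt: "\<And>v. \<alpha> x v v = 0"
  shows "hodge_star g \<alpha> x (f 1) (f 2) = \<alpha> x (f 3) (f 4)"
    "hodge_star g \<alpha> x (f 1) (f 3) = - \<alpha> x (f 2) (f 4)"
    "hodge_star g \<alpha> x (f 1) (f 4) = \<alpha> x (f 2) (f 3)"
    "hodge_star g \<alpha> x (f 2) (f 3) = \<alpha> x (f 1) (f 4)"
    "hodge_star g \<alpha> x (f 2) (f 4) = - \<alpha> x (f 1) (f 3)"
    "hodge_star g \<alpha> x (f 3) (f 4) = \<alpha> x (f 1) (f 2)"
proof -
  have "orthonormal_basis g x f" using f by (simp add: positive_orthonormal_basis_def)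
  note on = onb_eq[OF this]
  note skew = alternating_skew[OF \<alpha> alt]
  show "hodge_star g \<alpha> x (f 1) (f 2) = \<alpha> x (f 3) (f 4)"
    "hodge_star g \<alpha> x (f 1) (f 3) = - \<alpha> x (f 2) (f 4)"
    "hodge_star g \<alpha> x (f 1) (f 4) = \<alpha> x (f 2) (f 3)"
    "hodge_star g \<alpha> x (f 2) (f 3) = \<alpha> x (f 1) (f 4)"
    "hodge_star g \<alpha> x (f 2) (f 4) = - \<alpha> x (f 1) (f 3)"
    "hodge_star g \<alpha> x (f 3) (f 4) = \<alpha> x (f 1) (f 2)"
    unfolding hodge_star_onb[where \<alpha> = \<alpha>, OF f \<alpha>] sum_4 volume_form_onb[OF f] det_4
    using skew[of "f 4" "f 3"] skew[of "f 4" "f 2"] skew[of "f 4" "f 1"] skew[of "f 3" "f 2"]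
      skew[of "f 3" "f 1"] skew[of "f 2" "f 1"]
    by (simp_all add: comp_def on)
qed

end

section \<open>Hermitian linear algebra in complex dimension two\<close>

locale hermitian_point = euclidean_point g x for g :: "'m form2" and x :: 'm +
  fixes J :: "'m \<Rightarrow> real^4 \<Rightarrow> real^4"
  assumes lin_J: "linear (J x)"
    and J_J: "J x (J x v) = - v"
    and g_JJ: "g x (J x v) (J x w) = g x v w"
    and oriented: "v \<noteq> 0 \<Longrightarrow> w \<notin> span {v, J x v} \<Longrightarrow> positively_oriented v (J x v) w (J x w)"
begin

lemmas J_simps = linear_add[OF lin_J] linear_cmul[OF lin_J] linear_neg[OF lin_J] linear_diff[OF lin_J]
  linear_0[OF lin_J] J_J

lemma g_J_left: "g x (J x v) w = - g x v (J x w)"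
  using g_JJ[of v "J x w"] by (simp add: J_J g_simps)

lemma g_J_self: "g x v (J x v) = 0"
  using g_J_left[of v v] sym[of v "J x v"] by simp

text \<open>The real frame of a unitary basis. \<open>J\<close> has constant entries in it, so the
  pointwise identities below become finite computations.\<close>

definition adapted :: "(4 \<Rightarrow> real^4) \<Rightarrow> bool" where
  "adapted f \<longleftrightarrow> orthonormal_basis g x f \<and> J x (f 1) = f 2 \<and> J x (f 3) = f 4"

lemma unit_vector_orthogonal:
  assumes "w \<notin> span {v, J x v}" "g x v v = 1"
  obtains u where "g x u u = 1" "g x u v = 0" "g x u (J x v) = 0"
proof -
  define u where "u = w - g x w v *\<^sub>R v - g x w (J x v) *\<^sub>R J x v"
  have "u \<noteq> 0"
  proof
    assume "u = 0"
    then have "w = g x w v *\<^sub>R v + g x w (J x v) *\<^sub>R J x v" by (simp add: u_def algebra_simps)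
    then have "w \<in> span {v, J x v}"
      by (metis insertI1 insertI2 singletonI span_add span_base span_mul)
    with assms(1) show False by simp
  qed
  then have p: "g x u u > 0" by (rule pos)
  have o: "g x u v = 0" "g x u (J x v) = 0"
    using assms(2) g_J_self[of v] g_JJ[of v v] sym[of "J x v" v] by (simp_all add: u_def g_simps)
  let ?r = "1 / sqrt (g x u u)"
  have "g x (?r *\<^sub>R u) (?r *\<^sub>R u) = 1" "g x (?r *\<^sub>R u) v = 0" "g x (?r *\<^sub>R u) (J x v) = 0"
    using p o by (simp_all add: g_simps)
  then show ?thesis by (rule that)
qed

lemma adapted_exists: "\<exists>f. adapted f"
proof -
  define v0 :: "real^4" where "v0 = axis 1 1"
  have v0: "v0 \<noteq> 0" by (simp add: v0_def axis_eq_0_iff)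
  define v where "v = (1 / sqrt (g x v0 v0)) *\<^sub>R v0"
  have v: "g x v v = 1" using pos[OF v0] by (simp add: v_def g_simps)
  have "dim (span {v, J x v}) < DIM(real^4)"
    using dim_le_card'[of "{v, J x v}"] by (simp add: card_insert_if split: if_splits)
  then obtain w where "w \<notin> span {v, J x v}"
    by (metis UNIV_I dim_UNIV less_irrefl subsetI subset_antisym top_greatest)
  then obtain u where u: "g x u u = 1" "g x u v = 0" "g x u (J x v) = 0"
    using v by (rule unit_vector_orthogonal)
  define f :: "4 \<Rightarrow> real^4" where
    "f i = (if i = 1 then v else if i = 2 then J x v else if i = 3 then u else J x u)" for i
  have s: "g x v u = 0" "g x (J x v) u = 0" "g x v (J x v) = 0" "g x (J x v) v = 0"
    "g x u (J x u) = 0" "g x (J x u) u = 0" "g x v (J x u) = 0" "g x (J x u) v = 0"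
    using u sym[of v u] sym[of u "J x v"] g_J_self[of v] g_J_self[of u] sym[of v "J x v"]
      sym[of u "J x u"] g_J_left[of v u] g_J_left[of u v] by simp_all
  have "\<forall>i j. g x (f i) (f j) = (if i = j then 1 else 0)"
    unfolding forall_4 using u v s by (simp add: f_def g_JJ)
  then have "adapted f"
    by (simp add: adapted_def orthonormal_basis_def) (simp add: f_def)
  then show ?thesis by blast
qed

lemma adapted_onb: "adapted f \<Longrightarrow> orthonormal_basis g x f"
  by (simp add: adapted_def)

lemma adapted_J:
  assumes "adapted f"
  shows "J x (f 1) = f 2" "J x (f 2) = - f 1" "J x (f 3) = f 4" "J x (f 4) = - f 3"
  using assms J_J[of "f 1"] J_J[of "f 3"] by (auto simp: adapted_def)

text \<open>The compatibility of \<open>J\<close> with the orientation is used here. It applies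
  because \<open>f 3\<close> lies outside the complex line of \<open>f 1\<close>.\<close>

lemma adapted_positive:
  assumes f: "adapted f"
  shows "positive_orthonormal_basis g x f"
proof -
  note on = onb_eq[OF adapted_onb[OF f]]
  have "f 1 \<noteq> 0" using on[of 1 1] by (auto simp: g_simps)
  moreover have "f 3 \<notin> span {f 1, J x (f 1)}"
  proof
    assume "f 3 \<in> span {f 1, J x (f 1)}"
    then obtain a where "f 3 - a *\<^sub>R f 1 \<in> span {f 2}"
      unfolding span_insert adapted_J[OF f] by auto
    then obtain b where "f 3 - a *\<^sub>R f 1 = b *\<^sub>R f 2" by (auto simp: span_singleton)
    then have "f 3 = a *\<^sub>R f 1 + b *\<^sub>R f 2" by (simp add: algebra_simps)
    then have "g x (f 3) (f 3) = g x (f 3) (a *\<^sub>R f 1 + b *\<^sub>R f 2)" by simp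
    then show False by (simp add: g_simps on)
  qed
  ultimately have "positively_oriented (f 1) (f 2) (f 3) (f 4)"
    using oriented[of "f 1" "f 3"] adapted_J[OF f] by simp
  then show ?thesis using adapted_onb[OF f] by (simp add: positive_orthonormal_basis_def)
qed

lemma linear_eq_onb:
  fixes L :: "real^4 \<Rightarrow> 'b::real_vector"
  assumes f: "orthonormal_basis g x f" and L: "linear L" and M: "linear M" and "\<And>i. L (f i) = M (f i)"
  shows "L v = M v"
proof -
  have "L (\<Sum>i\<in>UNIV. g x v (f i) *\<^sub>R f i) = M (\<Sum>i\<in>UNIV. g x v (f i) *\<^sub>R f i)"
    by (simp add: linear_sum[OF L] linear_cmul[OF L] linear_sum[OF M] linear_cmul[OF M] assms(4))
  then show ?thesis using onb_expand[OF f, of v] by simp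
qed

lemma bilinear_zero_onb:
  assumes F: "bilinear F" and f: "orthonormal_basis g x f" and 0: "\<And>i j. F (f i) (f j) = (0::real)"
  shows "F v w = 0"
proof -
  have l: "linear (F v)" "linear (\<lambda>v. F v w)" for v w using F by (auto simp: bilinear_def)
  have "F v w = F (\<Sum>i\<in>UNIV. g x v (f i) *\<^sub>R f i) (\<Sum>j\<in>UNIV. g x w (f j) *\<^sub>R f j)"
    using onb_expand[OF f, of v] onb_expand[OF f, of w] by simp
  also have "\<dots> = 0"
    by (simp add: linear_sum[OF l(1)] linear_sum[OF l(2)] linear_cmul[OF l(1)] linear_cmul[OF l(2)] 0)
  finally show ?thesis .
qed

lemma alternating_zero_onb:
  assumes F: "bilinear F" and alt: "\<And>v. F v v = (0::real)" and f: "orthonormal_basis g x f"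
    and 0: "F (f 1) (f 2) = 0" "F (f 1) (f 3) = 0" "F (f 1) (f 4) = 0"
      "F (f 2) (f 3) = 0" "F (f 2) (f 4) = 0" "F (f 3) (f 4) = 0"
  shows "F v w = 0"
proof -
  note skew = alternating_skew[OF F alt]
  have "\<forall>i j. F (f i) (f j) = 0"
    unfolding forall_4 using 0 alt skew[of "f 2" "f 1"] skew[of "f 3" "f 1"] skew[of "f 4" "f 1"]
      skew[of "f 3" "f 2"] skew[of "f 4" "f 2"] skew[of "f 4" "f 3"] by simp
  then show ?thesis using bilinear_zero_onb[OF F f] by blast
qed

section \<open>Anti-self-dual forms at a point and the endomorphisms acting on them\<close>

lemma asd_iff_adapted:
  assumes f: "adapted f" and \<alpha>: "bilinear (\<alpha> x)" and alt: "\<And>v. \<alpha> x v v = 0"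
  shows "(\<forall>v w. hodge_star g \<alpha> x v w = - \<alpha> x v w) \<longleftrightarrow>
    \<alpha> x (f 1) (f 2) = - \<alpha> x (f 3) (f 4) \<and> \<alpha> x (f 1) (f 3) = \<alpha> x (f 2) (f 4) \<and>
    \<alpha> x (f 1) (f 4) = - \<alpha> x (f 2) (f 3)"
proof -
  note f' = adapted_positive[OF f]
  note frame = hodge_star_frame[where \<alpha> = \<alpha>, OF f' \<alpha> alt]
  \<comment> \<open>Anti-self-duality says that this alternating form vanishes. Its six frame
    components agree in pairs up to sign, which leaves three equations.\<close>
  let ?H = "\<lambda>v w. hodge_star g \<alpha> x v w + \<alpha> x v w"
  note l = linear_add[OF linear_comp] linear_cmul[OF linear_comp]
  note \<alpha>' = bilinear_ladd[OF \<alpha>] bilinear_radd[OF \<alpha>] bilinear_lmul[OF \<alpha>] bilinear_rmul[OF \<alpha>]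
  have lin: "linear (\<lambda>v. volume_form g x a b v w)" "linear (volume_form g x a b w)" for a b w
    by (rule linearI; simp add: volume_form_onb[OF f'] det_4 l algebra_simps)+
  have lin_\<alpha>: "linear (\<alpha> x v)" "linear (\<lambda>v. \<alpha> x v w)" for v w
    using \<alpha> by (auto simp: bilinear_def)
  have "linear (\<lambda>w. (1/2) *\<^sub>R (\<Sum>j\<in>UNIV. \<Sum>k\<in>UNIV. \<alpha> x (f j) (f k) *\<^sub>R volume_form g x (f j) (f k) v w) + \<alpha> x v w)"
    "linear (\<lambda>v. (1/2) *\<^sub>R (\<Sum>j\<in>UNIV. \<Sum>k\<in>UNIV. \<alpha> x (f j) (f k) *\<^sub>R volume_form g x (f j) (f k) v w) + \<alpha> x v w)" for v w
    by (intro linear_compose_add linear_compose_scale_right linear_compose_sum ballI lin lin_\<alpha>)+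
  then have lin_H: "linear (?H v)" "linear (\<lambda>v. ?H v w)" for v w
    by (simp_all add: hodge_star_onb[where \<alpha> = \<alpha>, OF f' \<alpha>])
  then have bil_H: "bilinear ?H" by (simp add: bilinear_def)
  have "?H v v = 0" for v
    unfolding hodge_star_onb[where \<alpha> = \<alpha>, OF f' \<alpha>] volume_form_onb[OF f'] alt det_4
    by (simp add: algebra_simps)
  note zero = alternating_zero_onb[OF bil_H this adapted_onb[OF f]]
  show ?thesis
  proof
    assume "\<forall>v w. hodge_star g \<alpha> x v w = - \<alpha> x v w"
    then show "\<alpha> x (f 1) (f 2) = - \<alpha> x (f 3) (f 4) \<and> \<alpha> x (f 1) (f 3) = \<alpha> x (f 2) (f 4) \<and>
        \<alpha> x (f 1) (f 4) = - \<alpha> x (f 2) (f 3)"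
      using frame by fastforce
  next
    assume *: "\<alpha> x (f 1) (f 2) = - \<alpha> x (f 3) (f 4) \<and> \<alpha> x (f 1) (f 3) = \<alpha> x (f 2) (f 4) \<and>
        \<alpha> x (f 1) (f 4) = - \<alpha> x (f 2) (f 3)"
    have "?H v w = 0" for v w by (rule zero) (use * in \<open>auto simp: frame\<close>)
    then show "\<forall>v w. hodge_star g \<alpha> x v w = - \<alpha> x v w" by (simp add: eq_neg_iff_add_eq_0)
  qed
qed

lemma g_onb_components:
  assumes f: "orthonormal_basis g x f"
  shows "v = g x v (f 1) *\<^sub>R f 1 + g x v (f 2) *\<^sub>R f 2 + g x v (f 3) *\<^sub>R f 3 + g x v (f 4) *\<^sub>R f 4"
  using onb_expand[OF f, of v] by (simp add: sum_4)

text \<open>With an index lowered, \<open>C\<close> is a self-dual form orthogonal to \<omega>, and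
  the self-dual and anti-self-dual parts of so(4) commute. In an adapted frame \<open>C\<close>
  depends on two numbers \<open>p\<close>, \<open>q\<close>, and the six components are
  checked.\<close>

lemma asd_annihilated_by_antilinear:
  assumes \<alpha>: "bilinear (\<alpha> x)" and alt: "\<And>v. \<alpha> x v v = 0"
    and asd: "\<And>v w. hodge_star g \<alpha> x v w = - \<alpha> x v w"
    and C: "linear C" and skew: "\<And>v w. g x (C v) w = - g x v (C w)"
    and anti: "\<And>v. C (J x v) = - J x (C v)"
  shows "\<alpha> x (C v) w + \<alpha> x v (C w) = 0"
proof -
  obtain f where f: "adapted f" using adapted_exists by blast
  note on = adapted_onb[OF f] and J = adapted_J[OF f]
  have a: "\<alpha> x (f 1) (f 2) = - \<alpha> x (f 3) (f 4)" "\<alpha> x (f 1) (f 3) = \<alpha> x (f 2) (f 4)"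
    "\<alpha> x (f 1) (f 4) = - \<alpha> x (f 2) (f 3)"
    using asd_iff_adapted[where \<alpha> = \<alpha>, OF f \<alpha> alt] asd by auto
  note \<alpha>' = bilinear_ladd[OF \<alpha>] bilinear_radd[OF \<alpha>] bilinear_lmul[OF \<alpha>] bilinear_rmul[OF \<alpha>]
    bilinear_lneg[OF \<alpha>] bilinear_rneg[OF \<alpha>] bilinear_lsub[OF \<alpha>] bilinear_rsub[OF \<alpha>]
  note sk = alternating_skew[OF \<alpha> alt]
  define p q where "p = g x (C (f 1)) (f 3)" and "q = g x (C (f 1)) (f 4)"
  have c11: "g x (C (f 1)) (f 1) = 0" using skew[of "f 1" "f 1"] sym[of "C (f 1)" "f 1"] by simp
  \<comment> \<open>Skewness and anticommutation with \<open>J\<close> show this number to be its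
    own negative.\<close>
  have c12: "g x (C (f 1)) (f 2) = 0"
  proof -
    have "g x (C (f 1)) (f 2) = - g x (f 1) (C (J x (f 1)))" using skew[of "f 1" "f 2"] J by simp
    also have "\<dots> = - g x (C (f 1)) (f 2)"
      using g_J_left[of "C (f 1)" "f 1"] J sym[of "f 1" "J x (C (f 1))"]
      by (simp add: anti[of "f 1", unfolded J] g_simps)
    finally show ?thesis by simp
  qed
  have C1: "C (f 1) = p *\<^sub>R f 3 + q *\<^sub>R f 4"
    using g_onb_components[OF on, of "C (f 1)"] c11 c12 by (simp add: p_def q_def)
  have C2: "C (f 2) = q *\<^sub>R f 3 - p *\<^sub>R f 4"
    using anti[of "f 1"] by (simp add: J C1 J_simps algebra_simps)
  have c33: "g x (C (f 3)) (f 3) = 0" using skew[of "f 3" "f 3"] sym[of "C (f 3)" "f 3"] by simp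
  have c34: "g x (C (f 3)) (f 4) = 0"
  proof -
    have "g x (C (f 3)) (f 4) = - g x (f 3) (C (J x (f 3)))" using skew[of "f 3" "f 4"] J by simp
    also have "\<dots> = - g x (C (f 3)) (f 4)"
      using g_J_left[of "C (f 3)" "f 3"] J sym[of "f 3" "J x (C (f 3))"]
      by (simp add: anti[of "f 3", unfolded J] g_simps)
    finally show ?thesis by simp
  qed
  have C3: "C (f 3) = - p *\<^sub>R f 1 - q *\<^sub>R f 2"
    using g_onb_components[OF on, of "C (f 3)"] c33 c34 skew[of "f 3" "f 1"] skew[of "f 3" "f 2"]
    by (simp add: C1 C2 g_simps onb_eq[OF on])
  have C4: "C (f 4) = p *\<^sub>R f 2 - q *\<^sub>R f 1"
    using anti[of "f 3"] by (simp add: J C3 J_simps algebra_simps)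
  note lC = linear_add[OF C] linear_cmul[OF C]
  have "bilinear (\<lambda>v w. \<alpha> x (C v) w + \<alpha> x v (C w))"
    unfolding bilinear_def by (auto intro!: linearI simp: \<alpha>' lC algebra_simps)
  moreover have "\<alpha> x (C v) v + \<alpha> x v (C v) = 0" for v using sk[of v "C v"] by simp
  ultimately show ?thesis
    by (rule alternating_zero_onb[OF _ _ on])
       (use a sk[of "f 4" "f 3"] sk[of "f 4" "f 2"] sk[of "f 4" "f 1"] sk[of "f 3" "f 2"]
      sk[of "f 3" "f 1"] sk[of "f 2" "f 1"] in \<open>simp_all add: C1 C2 C3 C4 \<alpha>' alt algebra_simps\<close>)
qed

text \<open>Anti-self-dual forms are \<open>J\<close>-invariant, and invariance applied to
  \<open>J x v\<close> and \<open>w\<close> is this identity.\<close>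

lemma asd_annihilated_by_J:
  assumes \<alpha>: "bilinear (\<alpha> x)" and alt: "\<And>v. \<alpha> x v v = 0"
    and asd: "\<And>v w. hodge_star g \<alpha> x v w = - \<alpha> x v w"
  shows "\<alpha> x (J x v) w + \<alpha> x v (J x w) = 0"
proof -
  obtain f where f: "adapted f" using adapted_exists by blast
  note on = adapted_onb[OF f] and J = adapted_J[OF f]
  have a: "\<alpha> x (f 1) (f 2) = - \<alpha> x (f 3) (f 4)" "\<alpha> x (f 1) (f 3) = \<alpha> x (f 2) (f 4)"
    "\<alpha> x (f 1) (f 4) = - \<alpha> x (f 2) (f 3)"
    using asd_iff_adapted[where \<alpha> = \<alpha>, OF f \<alpha> alt] asd by auto
  note \<alpha>' = bilinear_ladd[OF \<alpha>] bilinear_radd[OF \<alpha>] bilinear_lmul[OF \<alpha>] bilinear_rmul[OF \<alpha>]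
    bilinear_lneg[OF \<alpha>] bilinear_rneg[OF \<alpha>]
  note sk = alternating_skew[OF \<alpha> alt]
  have "bilinear (\<lambda>v w. \<alpha> x (J x v) w + \<alpha> x v (J x w))"
    unfolding bilinear_def by (auto intro!: linearI simp: \<alpha>' J_simps algebra_simps)
  moreover have "\<alpha> x (J x v) v + \<alpha> x v (J x v) = 0" for v using sk[of v "J x v"] by simp
  ultimately show ?thesis
    by (rule alternating_zero_onb[OF _ _ on]) (use a in \<open>simp_all add: J \<alpha>' alt\<close>)
qed

text \<open>The \<open>J\<close>-invariant part of \<open>u\<^sup>\<flat> \<and> w\<^sup>\<flat>\<close>, with its component along the fundamental form
  removed. Every anti-self-dual form at a point is a combination of such forms.\<close>

definition asd_form :: "real^4 \<Rightarrow> real^4 \<Rightarrow> real^4 \<Rightarrow> real^4 \<Rightarrow> real" where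
  "asd_form u w v v' = g x u v * g x w v' - g x u v' * g x w v
     + g x (J x u) v * g x (J x w) v' - g x (J x u) v' * g x (J x w) v
     - g x (J x u) w * g x (J x v) v'"

lemma bilinear_asd_form: "bilinear (asd_form u w)"
  unfolding bilinear_def by (auto intro!: linearI simp: asd_form_def g_simps J_simps algebra_simps)

lemma asd_form_alternating: "asd_form u w v v = 0"
  using g_J_self[of v] sym[of v "J x v"] by (simp add: asd_form_def)

lemma asd_form_asd:
  assumes "\<alpha> x = asd_form u w"
  shows "hodge_star g \<alpha> x v v' = - \<alpha> x v v'"
proof -
  obtain f where f: "adapted f" using adapted_exists by blast
  note on = adapted_onb[OF f] and J = adapted_J[OF f]
  have Jc: "g x (J x v) (f 1) = - g x v (f 2)" "g x (J x v) (f 2) = g x v (f 1)"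
    "g x (J x v) (f 3) = - g x v (f 4)" "g x (J x v) (f 4) = g x v (f 3)" for v
    by (simp_all add: g_J_left J g_simps)
  \<comment> \<open>Parseval writes the coefficient of \<omega> in frame components, so that the
    three equations become polynomial identities.\<close>
  have "g x (J x u) w = - g x u (f 2) * g x w (f 1) + g x u (f 1) * g x w (f 2)
      - g x u (f 4) * g x w (f 3) + g x u (f 3) * g x w (f 4)"
    using parseval[OF on, of "J x u" w] by (simp add: sum_4 Jc)
  then show ?thesis
    using asd_iff_adapted[where \<alpha> = \<alpha>, OF f] bilinear_asd_form[of u w] asd_form_alternating[of u w] assms
    by (simp add: asd_form_def Jc J onb_eq[OF on] g_simps algebra_simps)
qed

text \<open>\<open>B\<close> lies in u(2) and is given by the four numbers \<open>b\<close>,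
  \<open>c\<close>, \<open>p\<close>, \<open>q\<close>. To annihilate the anti-self-dual forms is to
  commute with su(2), whose centraliser in u(2) is the line of \<open>J\<close>.\<close>

lemma unitary_asd_trivial:
  assumes B: "linear B" and skew: "\<And>v w. g x (B v) w = - g x v (B w)"
    and comm: "\<And>v. B (J x v) = J x (B v)"
    and triv: "\<And>u w v v'. asd_form u w (B v) v' + asd_form u w v (B v') = 0"
  shows "\<exists>b. \<forall>v. B v = b *\<^sub>R J x v"
proof -
  obtain f where f: "adapted f" using adapted_exists by blast
  note on = adapted_onb[OF f] and J = adapted_J[OF f]
  define b p q where "b = g x (B (f 1)) (f 2)" and "p = g x (B (f 1)) (f 3)" and "q = g x (B (f 1)) (f 4)"
  define c where "c = g x (B (f 3)) (f 4)"
  have B1: "B (f 1) = b *\<^sub>R f 2 + p *\<^sub>R f 3 + q *\<^sub>R f 4"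
    using g_onb_components[OF on, of "B (f 1)"] skew[of "f 1" "f 1"] sym[of "B (f 1)" "f 1"]
    by (simp add: p_def q_def b_def)
  have B2: "B (f 2) = - b *\<^sub>R f 1 + p *\<^sub>R f 4 - q *\<^sub>R f 3"
    using comm[of "f 1"] by (simp add: J B1 J_simps)
  have B3: "B (f 3) = - p *\<^sub>R f 1 + q *\<^sub>R f 2 + c *\<^sub>R f 4"
    using g_onb_components[OF on, of "B (f 3)"] skew[of "f 3" "f 3"] sym[of "B (f 3)" "f 3"]
      skew[of "f 3" "f 1"] skew[of "f 3" "f 2"]
    by (simp add: c_def[symmetric] B1 B2 g_simps onb_eq[OF on])
  have B4: "B (f 4) = - p *\<^sub>R f 2 - q *\<^sub>R f 1 - c *\<^sub>R f 3"
    using comm[of "f 3"] by (simp add: J B3 J_simps)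
  note s = asd_form_def B1 B2 B3 B4 J J_simps g_simps onb_eq[OF on]
  \<comment> \<open>With eij the wedge of the dual covectors, \<open>asd_form (f 1) (f 2)\<close> is
    e12 - e34 and detects \<open>q\<close> and \<open>p\<close>, while
    \<open>asd_form (f 1) (f 3)\<close> is e13 + e24 and compares \<open>c\<close> with
    \<open>b\<close>.\<close>
  have q: "q = 0" using triv[of "f 1" "f 2" "f 1" "f 3"] by (simp add: s)
  have p: "p = 0" using triv[of "f 1" "f 2" "f 1" "f 4"] by (simp add: s)
  have c: "c = b" using triv[of "f 1" "f 3" "f 1" "f 4"] by (simp add: s)
  have L: "linear (\<lambda>v. b *\<^sub>R J x v)" by (rule linearI) (simp_all add: J_simps algebra_simps)
  have "\<forall>i. B (f i) = b *\<^sub>R J x (f i)"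
    unfolding forall_4 by (simp add: B1 B2 B3 B4 p q c J)
  then have "B v = b *\<^sub>R J x v" for v
    using linear_eq_onb[OF on B L] by simp
  then show ?thesis by blast
qed

text \<open>With \<open>N X Y Z = g ((\<nabla>\<^sub>X J) Y) Z\<close>, the cyclic sum of \<open>N\<close> is \<open>d\<omega>\<close> and the trace of \<open>N\<close> in its
  first two arguments is the codifferential of \<open>\<omega>\<close>; these determine each other because \<open>\<omega>\<close> is
  self-dual.\<close>

lemma cyclic_sum_zero_iff_trace_zero:
  assumes N: "bilinear N" and skew: "\<And>u v w. g x (N u v) w = - g x v (N u w)"
    and anti: "\<And>u v. N u (J x v) = - J x (N u v)" and e: "orthonormal_basis g x e"
  shows "(\<forall>u v w. g x (N u v) w + g x (N v w) u + g x (N w u) v = 0) \<longleftrightarrow>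
    (\<Sum>k\<in>UNIV. N (e k) (e k)) = 0"
proof -
  obtain f where f: "adapted f" using adapted_exists by blast
  note on = adapted_onb[OF f] and J = adapted_J[OF f]
  define n where "n u v w = g x (N u v) w" for u v w
  have sk: "n u v w = - n u w v" for u v w
    using skew[of u v w] sym[of v "N u w"] by (simp add: n_def)
  have an: "n u (J x v) w = n u v (J x w)" for u v w
    using g_J_left[of "N u v" w] by (simp add: n_def anti g_simps)
  note N' = bilinear_ladd[OF N] bilinear_radd[OF N] bilinear_lmul[OF N] bilinear_rmul[OF N]
    bilinear_lneg[OF N] bilinear_rneg[OF N]
  have n_neg: "n u (- v) w = - n u v w" "n u v (- w) = - n u v w" for u v w
    by (simp_all add: n_def N' g_simps)
  have n_self: "n u v v = 0" for u v using sk[of u v v] by simp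
  \<comment> \<open>For fixed \<open>u\<close>, skewness and anticommutation with \<open>J\<close>
    leave only \<open>n u (f 1) (f 3)\<close> and \<open>n u (f 1) (f 4)\<close> free.\<close>
  have n12: "n u (f 1) (f 2) = 0" "n u (f 3) (f 4) = 0"
    and n24: "n u (f 2) (f 4) = - n u (f 1) (f 3)" and n23: "n u (f 2) (f 3) = n u (f 1) (f 4)" for u
    using an[of u "f 1" "f 1"] an[of u "f 3" "f 3"] an[of u "f 1" "f 4"] an[of u "f 1" "f 3"]
      sk[of u "f 1" "f 2"] sk[of u "f 3" "f 4"] by (simp_all add: J n_neg)
  have n_rev: "n u (f 2) (f 1) = 0" "n u (f 4) (f 3) = 0" "n u (f 3) (f 1) = - n u (f 1) (f 3)"
     "n u (f 4) (f 1) = - n u (f 1) (f 4)" "n u (f 3) (f 2) = - n u (f 1) (f 4)"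
     "n u (f 4) (f 2) = n u (f 1) (f 3)" for u
    using sk[of u "f 2" "f 1"] sk[of u "f 4" "f 3"] sk[of u "f 3" "f 1"] sk[of u "f 4" "f 1"]
      sk[of u "f 3" "f 2"] sk[of u "f 4" "f 2"] n12[of u] n23[of u] n24[of u] by simp_all
  note ns = n12 n24 n23 n_rev n_self
  have "(\<Sum>k\<in>UNIV. N (e k) (e k)) = (\<Sum>k\<in>UNIV. N (f k) (f k))"
    by (rule onb_trace_eq[OF N e on])
  then have "(\<Sum>k\<in>UNIV. N (e k) (e k)) = 0 \<longleftrightarrow> (\<Sum>k\<in>UNIV. N (f k) (f k)) = 0" by simp
  also have "\<dots> \<longleftrightarrow> (\<forall>i. g x (\<Sum>k\<in>UNIV. N (f k) (f k)) (f i) = 0)"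
    using onb_eqI[OF on, of "\<Sum>k\<in>UNIV. N (f k) (f k)" 0] by (auto simp: g_simps)
  also have "\<dots> \<longleftrightarrow> (\<forall>i. (\<Sum>k\<in>UNIV. n (f k) (f k) (f i)) = 0)"
    by (simp add: g_sum n_def)
  \<comment> \<open>By skewness, triples with a repeated index give no condition. The equation for
    three distinct indices is, up to sign, the trace equation for the remaining index, as the Hodge
    star predicts.\<close>
  also have "\<dots> \<longleftrightarrow> (\<forall>i j k. n (f i) (f j) (f k) + n (f j) (f k) (f i) + n (f k) (f i) (f j) = 0)"
    unfolding forall_4 sum_4 ns by auto
  also have "\<dots> \<longleftrightarrow> (\<forall>u v w. n u v w + n v w u + n w u v = 0)"
  proof safe
    fix u v w assume *: "\<forall>i j k. n (f i) (f j) (f k) + n (f j) (f k) (f i) + n (f k) (f i) (f j) = 0"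
    let ?c = "\<lambda>u v w. n u v w + n v w u + n w u v"
    have b: "bilinear (?c u)" for u
      unfolding bilinear_def n_def by (auto intro!: linearI simp: N' g_simps algebra_simps)
    have l: "linear (\<lambda>u. ?c u v w)"
      unfolding n_def by (auto intro!: linearI simp: N' g_simps algebra_simps)
    have "?c (f i) v w = 0" for i
      by (rule bilinear_zero_onb[OF b on]) (use * in blast)
    then show "?c u v w = 0"
      using linear_eq_onb[OF on l linear_zero] by simp
  qed blast
  finally show ?thesis by (simp add: n_def)
qed

section \<open>Squared norms after adding multiples of J\<close>

lemma J_onb_eq:
  assumes e: "orthonormal_basis g x e"
  shows "g x (J x (e i)) (J x (e j)) = (if i = j then 1 else 0)"
  by (simp add: g_JJ onb_eq[OF e])

text \<open>Pythagoras: for each \<open>j\<close> the endomorphism with values \<open>c j k\<close>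
  is orthogonal to \<open>J\<close>, and 4 is the squared norm of \<open>J\<close>.\<close>

lemma sum_norm_add_J:
  fixes a :: "4 \<Rightarrow> real"
  assumes e: "orthonormal_basis g x e" and c: "\<And>j. (\<Sum>k\<in>UNIV. g x (c j k) (J x (e k))) = 0"
  shows "(\<Sum>j\<in>UNIV. \<Sum>k\<in>UNIV. g x (c j k + a j *\<^sub>R J x (e k)) (c j k + a j *\<^sub>R J x (e k))) =
    (\<Sum>j\<in>UNIV. \<Sum>k\<in>UNIV. g x (c j k) (c j k)) + 4 * (\<Sum>j\<in>UNIV. (a j)\<^sup>2)"
proof -
  have "(\<Sum>k\<in>UNIV. g x (c j k + a j *\<^sub>R J x (e k)) (c j k + a j *\<^sub>R J x (e k))) =
      (\<Sum>k\<in>UNIV. g x (c j k) (c j k)) + 4 * (a j)\<^sup>2" for j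
  proof -
    have "g x (c j k + a j *\<^sub>R J x (e k)) (c j k + a j *\<^sub>R J x (e k)) =
        g x (c j k) (c j k) + 2 * a j * g x (c j k) (J x (e k)) + (a j)\<^sup>2" for k
      using sym[of "J x (e k)" "c j k"]
      by (simp add: g_simps J_onb_eq[OF e] power2_eq_square algebra_simps)
    then show ?thesis by (simp add: sum.distrib sum_distrib_left[symmetric] c)
  qed
  then show ?thesis by (simp add: sum.distrib sum_distrib_left)
qed

text \<open>Each half of the wedge contributes 4 times the sum of the squares of \<open>a\<close>,
  and their product, supported on \<open>j = k\<close>, takes away 2, hence the 6. As
  \<open>t\<close> is skew, both halves pair with it equally, which doubles the usual factor 2 to
  4.\<close>

lemma sum_norm_add_wedge_J:
  fixes a :: "4 \<Rightarrow> real"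
  assumes e: "orthonormal_basis g x e" and t: "\<And>j k. t j k = - t k j"
  shows "(\<Sum>j\<in>UNIV. \<Sum>k\<in>UNIV. g x (t j k + (a j *\<^sub>R J x (e k) - a k *\<^sub>R J x (e j)))
        (t j k + (a j *\<^sub>R J x (e k) - a k *\<^sub>R J x (e j)))) =
    (\<Sum>j\<in>UNIV. \<Sum>k\<in>UNIV. g x (t j k) (t j k)) +
    4 * (\<Sum>j\<in>UNIV. a j * (\<Sum>k\<in>UNIV. g x (t j k) (J x (e k)))) + 6 * (\<Sum>j\<in>UNIV. (a j)\<^sup>2)"
proof -
  let ?m = "\<lambda>j k. a j * g x (t j k) (J x (e k))"
  have "g x (t j k + (a j *\<^sub>R J x (e k) - a k *\<^sub>R J x (e j)))
        (t j k + (a j *\<^sub>R J x (e k) - a k *\<^sub>R J x (e j))) =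
      g x (t j k) (t j k) + 2 * ?m j k + 2 * ?m k j
      + ((a j)\<^sup>2 + (a k)\<^sup>2 - (if j = k then 2 * (a j)\<^sup>2 else 0))" for j k
    using sym[of "J x (e k)" "t j k"] sym[of "J x (e j)" "t j k"] t[of k j]
    by (simp add: g_simps J_onb_eq[OF e] power2_eq_square algebra_simps)
  then have "(\<Sum>j\<in>UNIV. \<Sum>k\<in>UNIV. g x (t j k + (a j *\<^sub>R J x (e k) - a k *\<^sub>R J x (e j)))
        (t j k + (a j *\<^sub>R J x (e k) - a k *\<^sub>R J x (e j)))) =
      (\<Sum>j\<in>UNIV. \<Sum>k\<in>UNIV. g x (t j k) (t j k)) + 2 * (\<Sum>j\<in>UNIV. \<Sum>k\<in>UNIV. ?m j k)
      + 2 * (\<Sum>j\<in>UNIV. \<Sum>k\<in>UNIV. ?m k j) + 6 * (\<Sum>j\<in>UNIV. (a j)\<^sup>2)"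
    by (simp add: sum.distrib sum_subtractf sum_distrib_left[symmetric])
  moreover have "(\<Sum>j\<in>UNIV. \<Sum>k\<in>UNIV. ?m k j) = (\<Sum>j\<in>UNIV. \<Sum>k\<in>UNIV. ?m j k)"
    by (rule sum.swap)
  ultimately show ?thesis by (simp add: sum_distrib_left)
qed

end

section \<open>Almost-Hermitian manifolds\<close>

locale almost_hermitian = oriented_manifold A for A :: "'m::t2_space chart set" +
  fixes g :: "'m form2" and J :: "'m \<Rightarrow> real^4 \<Rightarrow> real^4" and nabla :: "'m conn"
  assumes metric: "riemannian_metric A g"
    and lc: "levi_civita A g nabla"
    and acs: "almost_complex_structure A J"
    and orth: "orthogonal_structure g J"
    and compat: "compatible_with_orientation J"
begin

sublocale hermitian_point g x J for x
proof (intro hermitian_point.intro euclidean_point.intro hermitian_point_axioms.intro)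
  show "bilinear (g x)" "\<And>v w. g x v w = g x w v" "\<And>v. v \<noteq> 0 \<Longrightarrow> 0 < g x v v"
    using metric by (auto simp: riemannian_metric_def smooth_bilinear_form_def)
  show "linear (J x)" "\<And>v. J x (J x v) = - v"
    using acs by (auto simp: almost_complex_structure_def)
  show "\<And>v w. g x (J x v) (J x w) = g x v w"
    using orth by (simp add: orthogonal_structure_def)
  show "\<And>v w. v \<noteq> 0 \<Longrightarrow> w \<notin> span {v, J x v} \<Longrightarrow> positively_oriented v (J x v) w (J x w)"
    using compat by (simp add: compatible_with_orientation_def)
qed

lemma smooth_J: "smooth_vfield A X \<Longrightarrow> smooth_vfield A (\<lambda>y. J y (X y))"
  using acs by (simp add: almost_complex_structure_def)

lemma smooth_g: "smooth_vfield A X \<Longrightarrow> smooth_vfield A Y \<Longrightarrow> smooth_fun A (\<lambda>y. g y (X y) (Y y))"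
  using metric by (simp add: riemannian_metric_def smooth_bilinear_form_def)

lemma conn_smooth:
  "connection A D \<Longrightarrow> smooth_vfield A X \<Longrightarrow> smooth_vfield A Y \<Longrightarrow> smooth_vfield A (D X Y)"
  by (simp add: connection_def)

lemma conn_add_left:
  assumes "connection A D" "smooth_vfield A X" "smooth_vfield A Y" "smooth_vfield A Z"
  shows "D (\<lambda>y. X y + Y y) Z x = D X Z x + D Y Z x"
proof -
  have "D (\<lambda>y. X y + Y y) Z = (\<lambda>x. D X Z x + D Y Z x)"
    using assms unfolding connection_def by blast
  then show ?thesis by (rule fun_cong)
qed

lemma conn_add_right:
  assumes "connection A D" "smooth_vfield A X" "smooth_vfield A Y" "smooth_vfield A Z"
  shows "D X (\<lambda>y. Y y + Z y) x = D X Y x + D X Z x"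
proof -
  have "D X (\<lambda>y. Y y + Z y) = (\<lambda>x. D X Y x + D X Z x)"
    using assms unfolding connection_def by blast
  then show ?thesis by (rule fun_cong)
qed

lemma conn_scale_left:
  assumes "connection A D" "smooth_fun A f" "smooth_vfield A X" "smooth_vfield A Y"
  shows "D (\<lambda>y. f y *\<^sub>R X y) Y x = f x *\<^sub>R D X Y x"
proof -
  have "D (\<lambda>y. f y *\<^sub>R X y) Y = (\<lambda>x. f x *\<^sub>R D X Y x)"
    using assms unfolding connection_def by blast
  then show ?thesis by (rule fun_cong)
qed

lemma conn_scale_right:
  assumes "connection A D" "smooth_fun A f" "smooth_vfield A X" "smooth_vfield A Y"
  shows "D X (\<lambda>y. f y *\<^sub>R Y y) x = dir_deriv A X f x *\<^sub>R Y x + f x *\<^sub>R D X Y x"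
proof -
  have "D X (\<lambda>y. f y *\<^sub>R Y y) = (\<lambda>x. dir_deriv A X f x *\<^sub>R Y x + f x *\<^sub>R D X Y x)"
    using assms unfolding connection_def by blast
  then show ?thesis by (rule fun_cong)
qed

lemmas conn_rules = conn_add_left conn_add_right conn_scale_left conn_scale_right

lemma conn_uminus:
  assumes "connection A D" "smooth_vfield A X" "smooth_vfield A Y"
  shows "D X (\<lambda>y. - Y y) x = - D X Y x"
  using conn_scale_right[OF assms(1) smooth_fun_const[of "-1"] assms(2,3), of x]
  by (simp add: dir_deriv_def comp_def)

lemma tensorial_conn_diff:
  assumes "connection A D" "connection A D'"
  shows "tensorial (conn_diff D D')"
  unfolding tensorial_def tensorial_at_def conn_diff_def
  by (auto simp: conn_rules[OF assms(1)] conn_rules[OF assms(2)] algebra_simps)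

lemma nabla_conn: "connection A nabla"
  using lc by (simp add: levi_civita_def)

lemma nabla_metric:
  assumes "smooth_vfield A X" "smooth_vfield A Y" "smooth_vfield A Z"
  shows "dir_deriv A X (\<lambda>y. g y (Y y) (Z y)) x = g x (nabla X Y x) (Z x) + g x (Y x) (nabla X Z x)"
  using lc assms by (simp add: levi_civita_def metric_connection_def)

lemma lie_bracket_eq:
  "smooth_vfield A X \<Longrightarrow> smooth_vfield A Y \<Longrightarrow> lie_bracket A X Y x = nabla X Y x - nabla Y X x"
  using lc by (simp add: levi_civita_def torsion_def)

lemmas nabla_rules = conn_rules[OF nabla_conn]

section \<open>The covariant derivative of J\<close>

definition nabla_J :: "'m conn" where
  "nabla_J X Y x = nabla X (\<lambda>y. J y (Y y)) x - J x (nabla X Y x)"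

lemma tensorial_nabla_J: "tensorial nabla_J"
  unfolding tensorial_def tensorial_at_def nabla_J_def
  by (auto simp: J_simps nabla_rules smooth_J algebra_simps)

abbreviation N :: "'m \<Rightarrow> real^4 \<Rightarrow> real^4 \<Rightarrow> real^4" where
  "N \<equiv> tensor_at A nabla_J"

lemma bilinear_N: "bilinear (N x)"
  by (rule bilinear_tensor_at[OF tensorial_nabla_J])

text \<open>The differentiated form of J^2 = -1.\<close>

lemma nabla_J_anti:
  assumes "smooth_vfield A X" "smooth_vfield A Y"
  shows "nabla_J X (\<lambda>y. J y (Y y)) x = - J x (nabla_J X Y x)"
  by (simp add: nabla_J_def J_simps conn_uminus[OF nabla_conn] assms)

lemma N_anti: "N x u (J x v) = - J x (N x u v)"
proof -
  have "N x u (J x v) = nabla_J (extend A x u) (\<lambda>y. J y (extend A x v y)) x"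
    by (simp add: tensorial_tensor_at[OF tensorial_nabla_J] smooth_J extend)
  then show ?thesis by (simp add: nabla_J_anti extend) (simp add: tensor_at_def)
qed

text \<open>Differentiating g(JY, JZ) = g(Y, Z) gives a version with \<open>J x w\<close> in place
  of \<open>w\<close>; then \<open>w\<close> is written as \<open>J x (- J x w)\<close>.\<close>

lemma N_skew: "g x (N x u v) w = - g x v (N x u w)"
proof -
  have *: "g x (N x u v) (J x w) = - g x (J x v) (N x u w)" for w
  proof -
    let ?X = "extend A x u" and ?Y = "extend A x v" and ?Z = "extend A x w"
    let ?JY = "\<lambda>y. J y (?Y y)" and ?JZ = "\<lambda>y. J y (?Z y)"
    have "dir_deriv A ?X (\<lambda>y. g y (?JY y) (?JZ y)) x = dir_deriv A ?X (\<lambda>y. g y (?Y y) (?Z y)) x"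
      by (simp add: g_JJ)
    then have "g x (nabla ?X ?JY x) (J x w) + g x (J x v) (nabla ?X ?JZ x)
        = g x (nabla ?X ?Y x) w + g x v (nabla ?X ?Z x)"
      by (simp add: nabla_metric smooth_J extend)
    then show ?thesis
      by (simp add: tensor_at_def nabla_J_def g_simps g_JJ)
  qed
  have "g x (N x u v) w = g x (N x u v) (J x (- J x w))" by (simp add: J_simps)
  also have "\<dots> = - g x (J x v) (N x u (- J x w))" by (rule *)
  also have "\<dots> = - g x v (N x u w)"
    by (simp add: bilinear_rneg[OF bilinear_N] N_anti g_JJ)
  finally show ?thesis .
qed

lemma nabla_J_eq_N:
  "smooth_vfield A X \<Longrightarrow> smooth_vfield A Y \<Longrightarrow> nabla_J X Y x = N x (X x) (Y x)"
  by (rule tensorial_tensor_at[OF tensorial_nabla_J])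

text \<open>As \<nabla> is torsion-free, d\<omega> is the cyclic sum of \<nabla>\<omega>. As g is
  parallel, differentiating \<omega> amounts to differentiating \<open>J\<close>.\<close>

lemma ext_deriv_fundamental_form:
  assumes X: "smooth_vfield A X" and Y: "smooth_vfield A Y" and Z: "smooth_vfield A Z"
  shows "ext_deriv A (fundamental_form g J) X Y Z x =
    g x (N x (X x) (Y x)) (Z x) + g x (N x (Y x) (Z x)) (X x) + g x (N x (Z x) (X x)) (Y x)"
proof -
  have flip: "g x v (J x w) = - g x w (J x v)" for v w
    using g_J_left[of x v w] sym[of x w "J x v"] by simp
  have "g x (nabla_J Y Z x) (X x) = - g x (nabla_J Y X x) (Z x)"
    using N_skew[of x "Y x" "Z x" "X x"] sym[of x "Z x" "N x (Y x) (X x)"]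
    by (simp add: nabla_J_eq_N X Y Z)
  then show ?thesis
    using flip[of "Y x" "nabla X Z x"] flip[of "X x" "nabla Y Z x"] flip[of "X x" "nabla Z Y x"]
      flip[of "Z x" "nabla Y X x"]
    unfolding nabla_J_eq_N[OF X Y, symmetric] nabla_J_eq_N[OF Y Z, symmetric] nabla_J_eq_N[OF Z X, symmetric]
      ext_deriv_def fundamental_form_def nabla_metric[OF X smooth_J[OF Y] Z]
      nabla_metric[OF Y smooth_J[OF X] Z] nabla_metric[OF Z smooth_J[OF X] Y]
      lie_bracket_eq[OF X Y] lie_bracket_eq[OF X Z] lie_bracket_eq[OF Y Z]
    by (simp add: nabla_J_def J_simps g_simps g_J_left)
qed

lemma almost_kaehler_iff_cyclic:
  "almost_kaehler A g J \<longleftrightarrow>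
    (\<forall>x u v w. g x (N x u v) w + g x (N x v w) u + g x (N x w u) v = 0)"
proof
  assume *: "almost_kaehler A g J"
  show "\<forall>x u v w. g x (N x u v) w + g x (N x v w) u + g x (N x w u) v = 0"
  proof (intro allI)
    fix x u v w
    show "g x (N x u v) w + g x (N x v w) u + g x (N x w u) v = 0"
      using * ext_deriv_fundamental_form[of "extend A x u" "extend A x v" "extend A x w" x]
      by (simp add: almost_kaehler_def extend)
  qed
qed (simp add: almost_kaehler_def ext_deriv_fundamental_form)

section \<open>The connections of the class\<close>

text \<open>The mean of \<nabla> and its conjugate -J \<nabla> J. Averaging produces
  \<open>J\<close>-linearity, and the formula is built from operations that visibly preserve
  smoothness.\<close>

definition canonical :: "'m conn" where
  "canonical X Y x = (1/2) *\<^sub>R (nabla X Y x - J x (nabla X (\<lambda>y. J y (Y y)) x))"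

text \<open>The one-form is given by its metric dual \<open>V\<close>. Its smoothness is thus that
  of a field, and its value at one point can be prescribed through \<open>extend\<close>.\<close>

definition shifted :: "'m vfield \<Rightarrow> 'm conn" where
  "shifted V X Y x = canonical X Y x + g x (V x) (X x) *\<^sub>R J x (Y x)"

lemma connection_shifted:
  assumes V: "smooth_vfield A V"
  shows "connection A (shifted V)"
  unfolding connection_def shifted_def canonical_def
proof (intro conjI allI impI ext)
  fix X Y assume "smooth_vfield A X" "smooth_vfield A Y"
  then show "smooth_vfield A (\<lambda>x. (1/2) *\<^sub>R (nabla X Y x - J x (nabla X (\<lambda>y. J y (Y y)) x)) + g x (V x) (X x) *\<^sub>R J x (Y x))"
    by (intro smooth_vfield_add smooth_vfield_cmul smooth_vfield_diff smooth_vfield_scaleR smooth_J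
        smooth_g V conn_smooth[OF nabla_conn])
qed (simp_all add: nabla_rules smooth_J J_simps g_simps algebra_simps, simp add: vec_eq_iff)

text \<open>The conjugate of \<nabla> by the isometry \<open>J\<close> is metric too, hence so is
  the mean, and the added multiple of \<open>J\<close> is skew.\<close>

lemma shifted_metric: "smooth_vfield A V \<Longrightarrow> metric_connection A g (shifted V)"
  unfolding metric_connection_def
proof (intro allI impI)
  fix X Y Z x assume s: "smooth_vfield A X" "smooth_vfield A Y" "smooth_vfield A Z"
  let ?JY = "\<lambda>y. J y (Y y)" and ?JZ = "\<lambda>y. J y (Z y)"
  have "dir_deriv A X (\<lambda>y. g y (?JY y) (?JZ y)) x = dir_deriv A X (\<lambda>y. g y (Y y) (Z y)) x"
    by (simp add: g_JJ)
  then have "dir_deriv A X (\<lambda>y. g y (Y y) (Z y)) x =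
      g x (nabla X ?JY x) (J x (Z x)) + g x (J x (Y x)) (nabla X ?JZ x)"
    by (simp add: nabla_metric smooth_J s)
  then have "dir_deriv A X (\<lambda>y. g y (Y y) (Z y)) x =
      g x (nabla X ?JY x) (J x (Z x)) - g x (Y x) (J x (nabla X ?JZ x))"
    by (simp only: g_J_left)
  with nabla_metric[OF s, of x] show "dir_deriv A X (\<lambda>y. g y (Y y) (Z y)) x =
      g x (shifted V X Y x) (Z x) + g x (Y x) (shifted V X Z x)"
    unfolding shifted_def canonical_def g_simps g_J_left real_scaleR_def mult_minus_right
      right_diff_distrib
    by linarith
qed

lemma shifted_complex_linear: "complex_linear_connection A J (shifted V)"
  unfolding complex_linear_connection_def shifted_def canonical_def
  by (auto simp: J_simps conn_uminus[OF nabla_conn] algebra_simps)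

abbreviation C :: "'m \<Rightarrow> real^4 \<Rightarrow> real^4 \<Rightarrow> real^4" where
  "C x u v \<equiv> - (1/2) *\<^sub>R J x (N x u v)"

lemma shifted_diff:
  assumes "smooth_vfield A X" "smooth_vfield A Y"
  shows "shifted V X Y x = nabla X Y x + (C x (X x) (Y x) + g x (V x) (X x) *\<^sub>R J x (Y x))"
  unfolding nabla_J_eq_N[OF assms, symmetric]
  by (simp add: shifted_def canonical_def nabla_J_def J_simps algebra_simps)

text \<open>The difference from \<nabla> is \<open>C\<close> plus a multiple of \<open>J\<close>.
  The former is skew and anticommutes with \<open>J\<close>, so both annihilate anti-self-dual
  forms.\<close>

lemma shifted_same_induced: "same_induced_on_asd A g (shifted V) nabla"
  unfolding same_induced_on_asd_def
proof (intro allI impI)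
  fix \<alpha> X Y Z x
  assume asd: "anti_self_dual_form A g \<alpha>"
    and s: "smooth_vfield A X" "smooth_vfield A Y" "smooth_vfield A Z"
  have \<alpha>: "bilinear (\<alpha> x)" "\<And>v. \<alpha> x v v = 0" "\<And>v w. hodge_star g \<alpha> x v w = - \<alpha> x v w"
    using asd by (auto simp: anti_self_dual_form_def two_form_def smooth_bilinear_form_def)
  let ?C = "C x (X x)"
  note N' = bilinear_radd[OF bilinear_N] bilinear_rmul[OF bilinear_N]
  have "linear ?C" by (rule linearI) (simp_all add: N' J_simps algebra_simps)
  moreover have "g x (?C v) w = - g x v (?C w)" for v w
    using N_skew[of x "X x" v "J x w"] by (simp add: g_simps g_J_left N_anti)
  moreover have "?C (J x v) = - J x (?C v)" for v by (simp add: N_anti J_simps)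
  ultimately have 1: "\<alpha> x (?C v) w + \<alpha> x v (?C w) = 0" for v w
    by (rule asd_annihilated_by_antilinear[where \<alpha> = \<alpha>, OF \<alpha>])
  have 2: "\<alpha> x (J x v) w + \<alpha> x v (J x w) = 0" for v w
    by (rule asd_annihilated_by_J[where \<alpha> = \<alpha>, OF \<alpha>])
  have 3: "r * \<alpha> x (J x v) w + r * \<alpha> x v (J x w) = 0" for v w r
    using 2[of v w] by (simp add: distrib_left[symmetric])
  show "induced_conn A (shifted V) X \<alpha> Y Z x = induced_conn A nabla X \<alpha> Y Z x"
    using 1[of "Y x" "Z x"] 3[of "g x (V x) (X x)" "Y x" "Z x"]
    by (simp only: induced_conn_def shifted_diff[OF s(1,2)] shifted_diff[OF s(1,3)]
        bilinear_ladd[OF \<alpha>(1)] bilinear_radd[OF \<alpha>(1)] bilinear_lmul[OF \<alpha>(1)] bilinear_rmul[OF \<alpha>(1)])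
       simp
qed

abbreviation S :: "'m conn set" where
  "S \<equiv> conn_class A g J nabla"

lemma shifted_in_class: "smooth_vfield A V \<Longrightarrow> shifted V \<in> S"
  by (simp add: conn_class_def connection_shifted shifted_metric shifted_complex_linear
      shifted_same_induced)

lemma smooth_zero: "smooth_vfield A (\<lambda>y. 0)"
  using smooth_vfield_cmul[OF extend(1), of 0] by simp

lemma shifted_zero: "shifted (\<lambda>y. 0) = canonical"
  by (simp add: shifted_def fun_eq_iff g_simps)

lemma canonical_diff:
  "smooth_vfield A X \<Longrightarrow> smooth_vfield A Y \<Longrightarrow> canonical X Y x = nabla X Y x + C x (X x) (Y x)"
  using shifted_diff[of X Y "\<lambda>y. 0" x] by (simp add: shifted_zero g_simps)

lemma canonical_in_class: "canonical \<in> S"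
  using shifted_in_class[OF smooth_zero] by (simp add: shifted_zero)

text \<open>Agreement on anti-self-dual forms is a condition on global forms. Applied to extended
  vectors, this provides a global form with value \<open>asd_form x r s\<close> at \<open>x\<close>,
  which makes the condition usable there.\<close>

lemma asd_form_anti_self_dual:
  assumes "smooth_vfield A U" "smooth_vfield A W"
  shows "anti_self_dual_form A g (\<lambda>y. asd_form y (U y) (W y))"
  unfolding anti_self_dual_form_def two_form_def smooth_bilinear_form_def
proof (intro conjI allI impI)
  fix X Y assume "smooth_vfield A X" "smooth_vfield A Y"
  then show "smooth_fun A (\<lambda>y. asd_form y (U y) (W y) (X y) (Y y))"
    unfolding asd_form_def
    by (intro smooth_fun_diff smooth_fun_add smooth_fun_mult smooth_g smooth_J assms)
next
  fix x v v'
  show "hodge_star g (\<lambda>y. asd_form y (U y) (W y)) x v v' = - asd_form x (U x) (W x) v v'"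
    by (rule asd_form_asd) simp
qed (simp_all add: bilinear_asd_form asd_form_alternating)

lemma class_diff:
  assumes D: "D \<in> S"
  obtains a where "\<And>u v. tensor_at A (conn_diff D nabla) x u v = C x u v + a u *\<^sub>R J x v"
proof -
  \<comment> \<open>The comparison is with \<open>canonical\<close>, not with \<nabla>: two members
    of the class differ by an endomorphism that commutes with \<open>J\<close>, as the algebraic
    lemma on u(2) demands.\<close>
  let ?P = "conn_diff D canonical"
  let ?p = "tensor_at A ?P x"
  have conn: "connection A D" "connection A canonical"
    and met: "metric_connection A g D" "metric_connection A g canonical"
    and cl: "complex_linear_connection A J D" "complex_linear_connection A J canonical"
    and same: "same_induced_on_asd A g D nabla" "same_induced_on_asd A g canonical nabla"
    using D canonical_in_class by (auto simp: conn_class_def)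
  note ten = tensorial_conn_diff[OF conn]
  have "\<exists>b. \<forall>v. ?p u v = b *\<^sub>R J x v" for u
  proof (rule unitary_asd_trivial)
    let ?X = "extend A x u"
    show "linear (?p u)" using bilinear_tensor_at[OF ten] by (simp add: bilinear_def)
    show "g x (?p u v) w = - g x v (?p u w)" for v w
    proof -
      have "dir_deriv A ?X (\<lambda>y. g y (extend A x v y) (extend A x w y)) x
          = g x (E ?X (extend A x v) x) w + g x v (E ?X (extend A x w) x)"
        if "metric_connection A g E" for E
        using that by (simp add: metric_connection_def extend)
      from this[OF met(1)] this[OF met(2)] show ?thesis
        by (simp add: tensor_at_def conn_diff_def g_simps)
    qed
    show "?p u (J x v) = J x (?p u v)" for v
    proof -
      have "?p u (J x v) = ?P ?X (\<lambda>y. J y (extend A x v y)) x"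
        by (simp add: tensorial_tensor_at[OF ten] smooth_J extend)
      also have "\<dots> = J x (?P ?X (extend A x v) x)"
        using cl by (simp add: complex_linear_connection_def conn_diff_def extend J_simps)
      finally show ?thesis by (simp add: tensor_at_def)
    qed
    show "asd_form x r s (?p u v) w + asd_form x r s v (?p u w) = 0" for r s v w
    proof -
      let ?\<alpha> = "\<lambda>y. asd_form y (extend A x r y) (extend A x s y)"
      have "induced_conn A D ?X ?\<alpha> (extend A x v) (extend A x w) x =
          induced_conn A canonical ?X ?\<alpha> (extend A x v) (extend A x w) x"
        using same asd_form_anti_self_dual[OF extend(1) extend(1)]
        by (simp add: same_induced_on_asd_def extend)
      then show ?thesis
        by (simp add: induced_conn_def extend tensor_at_def conn_diff_def
            bilinear_lsub[OF bilinear_asd_form] bilinear_rsub[OF bilinear_asd_form])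
    qed
  qed
  then obtain b where b: "?p u v = b u *\<^sub>R J x v" for u v by metis
  have "tensor_at A (conn_diff D nabla) x u v = C x u v + b u *\<^sub>R J x v" for u v
  proof -
    have "tensor_at A (conn_diff D nabla) x u v =
        ?p u v + (canonical (extend A x u) (extend A x v) x - nabla (extend A x u) (extend A x v) x)"
      by (simp add: tensor_at_def conn_diff_def)
    also have "\<dots> = b u *\<^sub>R J x v + C x u v"
      by (simp add: b canonical_diff extend)
    finally show ?thesis by simp
  qed
  then show ?thesis by (rule that)
qed

lemma shifted_tensor:
  "tensor_at A (conn_diff (shifted V) nabla) x u v = C x u v + g x (V x) u *\<^sub>R J x v"
  by (simp add: tensor_at_def conn_diff_def shifted_diff extend)

text \<open>The bracket is expressed through the torsion-free \<nabla>, so the torsion of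
  \<open>D\<close> is the antisymmetrised difference from \<nabla>.\<close>

lemma torsion_tensor:
  "tensor_at A (torsion A D) x u v =
    tensor_at A (conn_diff D nabla) x u v - tensor_at A (conn_diff D nabla) x v u"
  by (simp add: tensor_at_def torsion_def conn_diff_def lie_bracket_eq extend)

section \<open>Norms of the difference and of the torsion\<close>

text \<open>The very choice made inside \<open>tensor_norm\<close>, named so that norms can be
  rewritten in terms of it.\<close>

definition frame :: "'m \<Rightarrow> 4 \<Rightarrow> real^4" where
  "frame x = (SOME e. orthonormal_basis g x e)"

lemma frame_onb: "orthonormal_basis g x (frame x)"
  unfolding frame_def using adapted_exists[of x] adapted_onb[of x] by (metis someI_ex)

lemma tensor_norm_le_iff:
  "tensor_norm A g x T \<le> tensor_norm A g x T' \<longleftrightarrow>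
    (\<Sum>j\<in>UNIV. \<Sum>k\<in>UNIV. g x (tensor_at A T x (frame x j) (frame x k)) (tensor_at A T x (frame x j) (frame x k)))
    \<le> (\<Sum>j\<in>UNIV. \<Sum>k\<in>UNIV. g x (tensor_at A T' x (frame x j) (frame x k)) (tensor_at A T' x (frame x j) (frame x k)))"
  by (simp add: tensor_norm_def Let_def frame_def[symmetric])

definition trace_N :: "'m \<Rightarrow> real^4" where
  "trace_N x = (\<Sum>k\<in>UNIV. N x (frame x k) (frame x k))"

lemma almost_kaehler_iff_trace: "almost_kaehler A g J \<longleftrightarrow> (\<forall>x. trace_N x = 0)"
  unfolding almost_kaehler_iff_cyclic trace_N_def
  using cyclic_sum_zero_iff_trace_zero[OF bilinear_N N_skew N_anti frame_onb] by auto

lemma distance_sum: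
  assumes a: "\<And>u v. tensor_at A (conn_diff D nabla) x u v = C x u v + a u *\<^sub>R J x v"
  shows "(\<Sum>j\<in>UNIV. \<Sum>k\<in>UNIV. g x (tensor_at A (conn_diff D nabla) x (frame x j) (frame x k))
      (tensor_at A (conn_diff D nabla) x (frame x j) (frame x k))) =
    (\<Sum>j\<in>UNIV. \<Sum>k\<in>UNIV. g x (C x (frame x j) (frame x k)) (C x (frame x j) (frame x k)))
      + 4 * (\<Sum>j\<in>UNIV. (a (frame x j))\<^sup>2)"
  unfolding a
proof (rule sum_norm_add_J[OF frame_onb])
  \<comment> \<open>Since \<open>J\<close> is an isometry, each summand below is a multiple of such
    a term, so \<open>C\<close> is orthogonal to \<open>J\<close>.\<close>
  have "g x (N x u v) v = 0" for u v
    using N_skew[of x u v v] sym[of x v "N x u v"] by simp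
  then show "(\<Sum>k\<in>UNIV. g x (C x (frame x j) (frame x k)) (J x (frame x k))) = 0" for j
    by (simp add: g_simps g_JJ)
qed

lemma torsion_sum:
  assumes a: "\<And>u v. tensor_at A (conn_diff D nabla) x u v = C x u v + a u *\<^sub>R J x v"
  defines "t \<equiv> \<lambda>j k. C x (frame x j) (frame x k) - C x (frame x k) (frame x j)"
  shows "(\<Sum>j\<in>UNIV. \<Sum>k\<in>UNIV. g x (tensor_at A (torsion A D) x (frame x j) (frame x k))
      (tensor_at A (torsion A D) x (frame x j) (frame x k))) =
    (\<Sum>j\<in>UNIV. \<Sum>k\<in>UNIV. g x (t j k) (t j k))
      - 2 * (\<Sum>j\<in>UNIV. a (frame x j) * g x (frame x j) (trace_N x)) + 6 * (\<Sum>j\<in>UNIV. (a (frame x j))\<^sup>2)"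
proof -
  have skew: "t j k = - t k j" for j k by (simp add: t_def)
  have tor: "tensor_at A (torsion A D) x (frame x j) (frame x k) =
      t j k + (a (frame x j) *\<^sub>R J x (frame x k) - a (frame x k) *\<^sub>R J x (frame x j))" for j k
    by (simp add: torsion_tensor a t_def)
  have "g x (N x u v) v = 0" for u v
    using N_skew[of x u v v] sym[of x v "N x u v"] by simp
  \<comment> \<open>The first term of \<open>t j k\<close> pairs to zero; the one with exchanged
    arguments leaves the diagonal of \<open>N\<close>. The sum over \<open>k\<close> is the trace,
    and -1/2 times the 4 of the wedge formula is the coefficient -2.\<close>
  then have "g x (t j k) (J x (frame x k)) = - (1/2) * g x (frame x j) (N x (frame x k) (frame x k))" for j k
    using N_skew[of x "frame x k" "frame x j" "frame x k"]
    by (simp add: t_def g_simps g_JJ)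
  then have s: "(\<Sum>k\<in>UNIV. g x (t j k) (J x (frame x k))) = - (1/2) * g x (frame x j) (trace_N x)" for j
    by (simp add: trace_N_def g_sum sum_distrib_left)
  show ?thesis
    unfolding tor sum_norm_add_wedge_J[OF frame_onb skew] s by (simp add: sum_distrib_left sum_negf)
qed

section \<open>The two implications\<close>

lemma zero_trace_if_closest_minimal:
  assumes close: "closest_in A g S nabla D" and min: "minimal_torsion_in A g S D"
  shows "trace_N x = 0"
proof -
  have D: "D \<in> S" using close by (simp add: closest_in_def)
  obtain a where a: "\<And>u v. tensor_at A (conn_diff D nabla) x u v = C x u v + a u *\<^sub>R J x v"
    using class_diff[OF D] by blast
  \<comment> \<open>The constant part of the distance is common to all members, so being at least as
    close as \<open>canonical\<close> leaves no room for a nonzero \<open>a\<close> on the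
    frame.\<close>
  have "tensor_norm A g x (conn_diff D nabla) \<le> tensor_norm A g x (conn_diff (shifted (\<lambda>y. 0)) nabla)"
    using close canonical_in_class by (simp add: closest_in_def shifted_zero)
  then have "(\<Sum>j\<in>UNIV. (a (frame x j))\<^sup>2) \<le> 0"
    unfolding tensor_norm_le_iff distance_sum[OF a] distance_sum[OF shifted_tensor]
    by (simp add: g_simps)
  then have a0: "a (frame x j) = 0" for j
    using sum_nonneg_eq_0_iff[of UNIV "\<lambda>j. (a (frame x j))\<^sup>2"] sum_nonneg[of UNIV "\<lambda>j. (a (frame x j))\<^sup>2"]
    by auto
  define r where "r j = g x (frame x j) (trace_N x)" for j
  \<comment> \<open>In each frame direction the torsion varies by -2 a r + 6 a^2, which is smallest
    at a = r/6 with value -r^2/6. As \<open>D\<close> has a = 0, its minimality forces r =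
    0.\<close>
  define V where "V = extend A x ((1/6) *\<^sub>R trace_N x)"
  have V: "smooth_vfield A V" "g x (V x) (frame x j) = (1/6) * r j" for j
    using sym[of x "trace_N x" "frame x j"] by (simp_all add: V_def extend r_def g_simps)
  have "tensor_norm A g x (torsion A D) \<le> tensor_norm A g x (torsion A (shifted V))"
    using min shifted_in_class[OF V(1)] by (simp add: minimal_torsion_in_def)
  then have "0 \<le> - 2 * (\<Sum>j\<in>UNIV. (1/6) * r j * r j) + 6 * (\<Sum>j\<in>UNIV. ((1/6) * r j)\<^sup>2)"
    unfolding tensor_norm_le_iff torsion_sum[OF a] torsion_sum[OF shifted_tensor]
    by (simp add: a0 V r_def)
  then have "(\<Sum>j\<in>UNIV. (r j)\<^sup>2) \<le> 0"
    by (simp add: power_divide sum_divide_distrib[symmetric] power2_eq_square)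
  then have "r j = 0" for j
    using sum_nonneg_eq_0_iff[of UNIV "\<lambda>j. (r j)\<^sup>2"] sum_nonneg[of UNIV "\<lambda>j. (r j)\<^sup>2"] by auto
  then have "g x (trace_N x) (frame x j) = g x 0 (frame x j)" for j
    using sym[of x "trace_N x" "frame x j"] by (simp add: r_def g_simps)
  then show ?thesis by (rule onb_eqI[OF frame_onb])
qed

lemma canonical_closest: "closest_in A g S nabla canonical"
  unfolding closest_in_def
proof (intro conjI allI ballI canonical_in_class)
  fix x D assume "D \<in> S"
  then obtain a where a: "\<And>u v. tensor_at A (conn_diff D nabla) x u v = C x u v + a u *\<^sub>R J x v"
    using class_diff by blast
  show "tensor_norm A g x (conn_diff canonical nabla) \<le> tensor_norm A g x (conn_diff D nabla)"
    unfolding shifted_zero[symmetric] tensor_norm_le_iff distance_sum[OF a] distance_sum[OF shifted_tensor]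
    by (simp add: g_simps sum_nonneg)
qed

text \<open>Once the linear term is gone, the squared torsion exceeds that of
  \<open>canonical\<close> by 6 times a sum of squares.\<close>

lemma canonical_minimal_torsion:
  assumes "\<And>x. trace_N x = 0"
  shows "minimal_torsion_in A g S canonical"
  unfolding minimal_torsion_in_def
proof (intro conjI allI ballI canonical_in_class)
  fix x D assume "D \<in> S"
  then obtain a where a: "\<And>u v. tensor_at A (conn_diff D nabla) x u v = C x u v + a u *\<^sub>R J x v"
    using class_diff by blast
  show "tensor_norm A g x (torsion A canonical) \<le> tensor_norm A g x (torsion A D)"
    unfolding shifted_zero[symmetric] tensor_norm_le_iff torsion_sum[OF a] torsion_sum[OF shifted_tensor]
    by (simp add: g_simps sum_nonneg assms)
qed

end

theorem corollary1p3:
  fixes A :: "'m::{t2_space, second_countable_topology} chart set"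
    and g :: "'m form2"
    and J :: "'m \<Rightarrow> real^4 \<Rightarrow> real^4"
    and nabla :: "'m conn"
  assumes "oriented_atlas A"
    and "riemannian_metric A g"
    and "levi_civita A g nabla"
    and "almost_complex_structure A J"
    and "orthogonal_structure g J"
    and "compatible_with_orientation J"
  shows "almost_kaehler A g J \<longleftrightarrow>
    (\<exists>D \<in> conn_class A g J nabla.
       closest_in A g (conn_class A g J nabla) nabla D \<and>
       minimal_torsion_in A g (conn_class A g J nabla) D)"
proof -
  interpret almost_hermitian A g J nabla
    using assms by unfold_locales
  show ?thesis
    unfolding almost_kaehler_iff_trace
    using zero_trace_if_closest_minimal canonical_closest canonical_minimal_torsion canonical_in_class
    by blast
qed

end
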